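(* For every achievable tuple $(k,D,\Delta)\in\mathcal R^*$ there exist random variables $U,V,Q,T$ on finite sets $\mathcal U,\mathcal V,\mathcal Q,\mathcal T$, an input distribution $p(x)$, and a function $\hat A:\mathcal V\times\mathcal B\to\mathcal A$ such that the joint distribution factorizes as $p(u,v,q,t,a,b,e,x,y,z)=p(u,v|a)\,p(a,b,e)\,p(q|t)\,p(t|x)\,p(x)\,P(y,z|x)$ and \begin{align*} I(V;A|B)&\le k\,I(T;Y),\\ D&\ge \mathbb{E}\big[d(A,\hat A(V,B))\big],\\ \Delta&\le H(A|U,E)-\Big[I(V;A|B)-I(U;A|B)-k\big(I(T;Y|Q)-I(T;Z|Q)\big)\Big]_+ . \end{align*}
   Context: Setup (secure lossy source-channel wiretapping). Let $\mathcal A,\mathcal B,\mathcal E,\mathcal X,\mathcal Y,\mathcal Z$ be finite sets. Alice, Bob and Eve observe sequences $(A_i)_{i\ge1}$, $(B_i)_{i\ge1}$, $(E_i)_{i\ge1}$ with values in $\mathcal A,\mathcal B,\mathcal E$; the triples $(A_i,B_i,E_i)$ are i.i.d. across $i$ with a given joint distribution $p(a,b,e)$. Alice communicates with Bob and Eve over a discrete memoryless channel with input $X\in\mathcal X$, outputs $Y\in\mathcal Y$ (at Bob) and $Z\in\mathcal Z$ (at Eve), and transition probability $P(y,z|x)$. Let $d:\mathcal A\times\mathcal A\to[0,d_{\max}]$ with $d_{\max}<\infty$ be a distortion measure, extended to sequences by $d(a^n,b^n)=\frac1n\sum_{i=1}^n d(a_i,b_i)$. An $(n,m)$-code consists of a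 stochastic encoder given by a transition probability $P_{X^m|A^n}$ from $\mathcal A^n$ to $\mathcal X^m$, and a decoder $g:\mathcal Y^m\times\mathcal B^n\to\mathcal A^n$; the channel input is $X^m$ produced by the encoder from $A^n$ and $(Y^m,Z^m)$ is the memoryless channel output. A tuple $(k,D,\Delta)\in\mathbb{R}_+^3$ is achievable if for every $\varepsilon>0$ there is an $(n,m)$-code with $m/n\le k+\varepsilon$, $\mathbb{E}[d(A^n,g(Y^m,B^n))]\le D+\varepsilon$, and $\frac1n H(A^n|E^n,Z^m)\ge\Delta-\varepsilon$. The set of achievable tuples is denoted $\mathcal R^*$. In single-letter expressions, $(A,B,E)\sim p(a,b,e)$ and $(Y,Z)$ is the output of $P(y,z|x)$ with input $X$. Notation: $[x]_+=\max(0,x)$. *)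

theory Defs
  imports "HOL-Probability.Probability"
begin

definition ent :: "'w pmf \<Rightarrow> ('w \<Rightarrow> 'v) \<Rightarrow> real" where
  "ent M X = - (\<Sum>v \<in> set_pmf (map_pmf X M).
      pmf (map_pmf X M) v * log 2 (pmf (map_pmf X M) v))"

definition cond_ent :: "'w pmf \<Rightarrow> ('w \<Rightarrow> 'v) \<Rightarrow> ('w \<Rightarrow> 'u) \<Rightarrow> real" where
  "cond_ent M X Y = ent M (\<lambda>w. (X w, Y w)) - ent M Y"

definition mutual_info :: "'w pmf \<Rightarrow> ('w \<Rightarrow> 'v) \<Rightarrow> ('w \<Rightarrow> 'u) \<Rightarrow> real" where
  "mutual_info M X Y = ent M X + ent M Y - ent M (\<lambda>w. (X w, Y w))"

definition cond_mutual_info ::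
  "'w pmf \<Rightarrow> ('w \<Rightarrow> 'v) \<Rightarrow> ('w \<Rightarrow> 'u) \<Rightarrow> ('w \<Rightarrow> 's) \<Rightarrow> real" where
  "cond_mutual_info M X Y Z =
     ent M (\<lambda>w. (X w, Z w)) + ent M (\<lambda>w. (Y w, Z w))
     - ent M (\<lambda>w. (X w, Y w, Z w)) - ent M Z"

primrec iid_pmf :: "nat \<Rightarrow> 's pmf \<Rightarrow> 's list pmf" where
  "iid_pmf 0 p = return_pmf []"
| "iid_pmf (Suc n) p = bind_pmf p (\<lambda>s. map_pmf (\<lambda>ss. s # ss) (iid_pmf n p))"

primrec chan_seq :: "('x \<Rightarrow> 'o pmf) \<Rightarrow> 'x list \<Rightarrow> 'o list pmf" where
  "chan_seq W [] = return_pmf []"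
| "chan_seq W (x # xs) = bind_pmf (W x) (\<lambda>r. map_pmf (\<lambda>rs. r # rs) (chan_seq W xs))"

definition code_joint ::
  "('a \<times> 'b \<times> 'e) pmf \<Rightarrow> ('x \<Rightarrow> ('y \<times> 'z) pmf) \<Rightarrow> nat \<Rightarrow> ('a list \<Rightarrow> 'x list pmf)
   \<Rightarrow> (('a \<times> 'b \<times> 'e) list \<times> 'x list \<times> ('y \<times> 'z) list) pmf" where
  "code_joint p W n enc =
     bind_pmf (iid_pmf n p) (\<lambda>s.
     bind_pmf (enc (map fst s)) (\<lambda>xs.
     map_pmf (\<lambda>yz. (s, xs, yz)) (chan_seq W xs)))"

definition seq_dist :: "('a \<Rightarrow> 'a \<Rightarrow> real) \<Rightarrow> nat \<Rightarrow> 'a list \<Rightarrow> 'a list \<Rightarrow> real" where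
  "seq_dist d n as bs = (1 / real n) * (\<Sum>i<n. d (as ! i) (bs ! i))"

definition achievable ::
  "('a::finite \<times> 'b::finite \<times> 'e::finite) pmf \<Rightarrow> ('x::finite \<Rightarrow> ('y::finite \<times> 'z::finite) pmf)
   \<Rightarrow> ('a \<Rightarrow> 'a \<Rightarrow> real) \<Rightarrow> real \<Rightarrow> real \<Rightarrow> real \<Rightarrow> bool" where
  "achievable p W d k D \<Delta> \<longleftrightarrow> 0 \<le> k \<and> 0 \<le> D \<and> 0 \<le> \<Delta> \<and>
     (\<forall>\<epsilon>>0. \<exists>(n::nat) (m::nat) (enc :: 'a list \<Rightarrow> 'x list pmf) (g :: 'y list \<Rightarrow> 'b list \<Rightarrow> 'a list).
        0 < n
      \<and> (\<forall>as. length as = n \<longrightarrow> (\<forall>xs \<in> set_pmf (enc as). length xs = m))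
      \<and> (\<forall>ys bs. length ys = m \<longrightarrow> length bs = n \<longrightarrow> length (g ys bs) = n)
      \<and> real m / real n \<le> k + \<epsilon>
      \<and> measure_pmf.expectation (code_joint p W n enc)
           (\<lambda>(s, xs, yz). seq_dist d n (map fst s) (g (map fst yz) (map (fst \<circ> snd) s)))
         \<le> D + \<epsilon>
      \<and> cond_ent (code_joint p W n enc) (\<lambda>(s, xs, yz). map fst s)
           (\<lambda>(s, xs, yz). (map (snd \<circ> snd) s, map snd yz)) / real n \<ge> \<Delta> - \<epsilon>)"

text \<open>p(u,v|a) p(a,b,e) p(q|t) p(t|x) p(x) P(y,z|x); auxiliary variables U,V,Q,T take
  values in (finite subsets of) nat.\<close>
definition sl_joint ::
  "('a \<times> 'b \<times> 'e) pmf \<Rightarrow> ('x \<Rightarrow> ('y \<times> 'z) pmf) \<Rightarrow> ('a \<Rightarrow> (nat \<times> nat) pmf) \<Rightarrow> 'x pmf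
   \<Rightarrow> ('x \<Rightarrow> nat pmf) \<Rightarrow> (nat \<Rightarrow> nat pmf)
   \<Rightarrow> ((nat \<times> nat \<times> nat \<times> nat) \<times> ('a \<times> 'b \<times> 'e) \<times> 'x \<times> ('y \<times> 'z)) pmf" where
  "sl_joint p W puv px pt pq =
     bind_pmf p (\<lambda>(a, b, e).
     bind_pmf (puv a) (\<lambda>(u, v).
     bind_pmf px (\<lambda>x.
     bind_pmf (pt x) (\<lambda>t.
     bind_pmf (pq t) (\<lambda>q.
     map_pmf (\<lambda>(y, z). ((u, v, q, t), (a, b, e), x, (y, z))) (W x))))))"

definition rvU where "rvU w = fst (fst w)"
definition rvV where "rvV w = fst (snd (fst w))"
definition rvQ where "rvQ w = fst (snd (snd (fst w)))"
definition rvT where "rvT w = snd (snd (snd (fst w)))"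
definition rvA where "rvA w = fst (fst (snd w))"
definition rvB where "rvB w = fst (snd (fst (snd w)))"
definition rvE where "rvE w = snd (snd (fst (snd w)))"
definition rvX where "rvX w = fst (snd (snd w))"
definition rvY where "rvY w = fst (snd (snd (snd w)))"
definition rvZ where "rvZ w = snd (snd (snd (snd w)))"

end

theory Submission
  imports Defs
begin

text \<open>
  Put \<open>U\<^sub>i = (B\<^bsup><i\<^esup>, E\<^bsup>>i\<^esup>, Z\<^sup>m)\<close>, \<open>V\<^sub>i = (Y\<^sup>m, B\<^bsup>\<noteq>i\<^esup>, A\<^bsup><i\<^esup>)\<close>,
  \<open>Q\<^sub>j = (B\<^sup>n, Y\<^bsup><j\<^esup>, Z\<^bsup>>j\<^esup>)\<close> and \<open>T\<^sub>j = (A\<^sup>n, Q\<^sub>j)\<close>. Every sum over positions then telescopes in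
  joint entropies such as \<open>H(B\<^bsup><i\<^esup>, E\<^bsup>\<ge>i\<^esup>, Z\<^sup>m)\<close> (this is Csiszar's sum identity), which gives the
  single-letter inequalities up to the slack \<open>\<epsilon>\<close> of the code.

  The inequalities see \<open>U\<close> and \<open>V\<close> only through their separate joint laws with \<open>A\<close>, and each
  information quantity is an average, over the values of the auxiliary variable, of a continuous
  function of the conditional law of \<open>A\<close> (or of \<open>X\<close>). So the attainable tuples form convex hulls of
  compact subsets of a Euclidean space. These hulls are compact, which replaces the usual cardinality
  bounds: let \<open>\<epsilon>\<close> tend to zero inside them, and read off finite auxiliary variables from a convex
  combination representing the limit point.
\<close>

section \<open>Entropy of finitely supported distributions\<close>

text \<open>The auxiliary variables are admissible by an invariance: \<open>U_i\<close> and
  \<open>V_i\<close> never read the pair \<open>(B_i, E_i)\<close>, and \<open>T_j\<close> never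
  reads \<open>(Y_j, Z_j)\<close>. Redrawing such a pair from its kernel preserves the law of the
  whole code and does not move the auxiliary variable, which is exactly the required Markov chain.
  The positive part in the claim stands for two bounds. One is
  \<open>H(A^n|E^n,Z^m) <= sum H(A_i|U_i,E_i)\<close>. The other is an exact identity:
  \<open>H(A^n|E^n,Z^m)\<close> equals the sum of
  \<open>H(A_i|U_i,E_i) + H(A_i|V_i,B_i) - H(A_i|U_i,B_i)\<close> over \<open>i\<close> plus the sum
  of \<open>H(Y_j|Q_j) - H(Z_j|Q_j) - H(Y_j|T_j) + H(Z_j|T_j)\<close> over \<open>j\<close>. The
  obstacle is that Eve's side speaks of \<open>E\<close> and the channel sums of \<open>B\<close>.
  Given \<open>A_i\<close>, both letters are independent of the rest, so exchanging them always
  costs the constant \<open>H(E|A) - H(B|A)\<close>, and these constants cancel in the end.\<close>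

definition eta :: "real \<Rightarrow> real" where
  "eta x = - x * log 2 x"

lemma eta_0 [simp]: "eta 0 = 0" and eta_1 [simp]: "eta 1 = 0"
  by (simp_all add: eta_def)

text \<open>The terms \<open>x * eta c\<close> are what later cancels between the two halves of
  \<open>output_ent\<close> and makes it homogeneous.\<close>

lemma eta_mult:
  assumes "0 \<le> c" "0 \<le> x"
  shows "eta (c * x) = c * eta x + x * eta c"
  using assms by (cases "c = 0"; cases "x = 0") (auto simp: eta_def log_mult algebra_simps)

text \<open>The right side is the tangent of the concave function \<open>eta\<close> at
  \<open>y\<close>; it lies above the graph because \<open>ln (y / x) <= y / x - 1\<close>. This
  form also covers \<open>x = 0\<close>, where \<open>eta\<close> has no derivative.\<close>

lemma eta_tangent:
  assumes "0 \<le> x" "0 < y"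
  shows "eta x \<le> - x * log 2 y + (y - x) / ln 2"
proof (cases "x = 0")
  case True
  then show ?thesis using assms by simp
next
  case False
  with assms have x: "x > 0" by simp
  have "x * (ln y - ln x) \<le> y - x"
  proof -
    have "ln (y / x) \<le> y / x - 1" using x assms by (intro ln_le_minus_one) simp
    then have "x * ln (y / x) \<le> x * (y / x - 1)" using x by (intro mult_left_mono) auto
    then show ?thesis using x assms by (simp add: ln_div algebra_simps)
  qed
  then have "(x * (ln y - ln x)) / ln 2 \<le> (y - x) / ln 2"
    by (intro divide_right_mono) auto
  then show ?thesis by (simp add: eta_def log_def algebra_simps diff_divide_distrib)
qed

text \<open>Jensen: average the tangents taken at the mean \<open>?y\<close>, so that the linear
  terms cancel. At mean zero there is no tangent, but then every \<open>c i * x i\<close>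
  vanishes.\<close>

lemma eta_concave:
  assumes "finite I" "\<And>i. i \<in> I \<Longrightarrow> 0 \<le> c i" "\<And>i. i \<in> I \<Longrightarrow> 0 \<le> x i" "sum c I = 1"
  shows "(\<Sum>i\<in>I. c i * eta (x i)) \<le> eta (\<Sum>i\<in>I. c i * x i)"
proof -
  let ?y = "\<Sum>i\<in>I. c i * x i"
  have y0: "?y \<ge> 0" using assms by (intro sum_nonneg) auto
  show ?thesis
  proof (cases "?y = 0")
    case True
    then have "\<forall>i\<in>I. c i * x i = 0"
      using assms by (subst (asm) sum_nonneg_eq_0_iff) auto
    then have "(\<Sum>i\<in>I. c i * eta (x i)) = 0" by (intro sum.neutral) (auto simp: eta_def)
    then show ?thesis using True by simp
  next
    case False
    then have y: "?y > 0" using y0 by simp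
    have "(\<Sum>i\<in>I. c i * eta (x i)) \<le> (\<Sum>i\<in>I. c i * (- x i * log 2 ?y + (?y - x i) / ln 2))"
      using assms eta_tangent[OF _ y] by (intro sum_mono mult_left_mono) auto
    also have "\<dots> = (\<Sum>i\<in>I. (c i * x i) * (- log 2 ?y - 1 / ln 2) + c i * (?y / ln 2))"
      by (intro sum.cong) (auto simp: algebra_simps diff_divide_distrib)
    also have "\<dots> = ?y * (- log 2 ?y - 1 / ln 2) + sum c I * (?y / ln 2)"
      by (simp only: sum.distrib sum_distrib_right)
    also have "\<dots> = eta ?y" using assms by (simp add: eta_def algebra_simps)
    finally show ?thesis .
  qed
qed

text \<open>Only the origin needs care: substituting \<open>x = 1 / t\<close> turns
  \<open>x * ln x\<close> into \<open>- ln t / t\<close>, which tends to 0.\<close>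

lemma continuous_on_eta: "continuous_on {0..} eta"
proof -
  have *: "((\<lambda>x::real. x * ln x) \<longlongrightarrow> 0) (at 0 within {0..})"
  proof -
    have "((\<lambda>x::real. x * ln x) \<longlongrightarrow> 0) (at_right 0)"
    proof (subst filterlim_at_right_to_top)
      have "((\<lambda>x::real. - (ln x / x)) \<longlongrightarrow> - 0) at_top"
        by (intro tendsto_minus ln_x_over_x_tendsto_0)
      then have "((\<lambda>x::real. - (ln x / x)) \<longlongrightarrow> 0) at_top" by simp
      then show "((\<lambda>x::real. inverse x * ln (inverse x)) \<longlongrightarrow> 0) at_top"
        by (rule Lim_transform_eventually)
          (auto intro!: eventually_mono[OF eventually_gt_at_top[of 0]] simp: ln_inverse divide_inverse)
    qed
    moreover have "at (0::real) within {0..} = at_right 0"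
      by (rule at_within_nhd[of _ UNIV]) auto
    ultimately show ?thesis by simp
  qed
  have "continuous_on {0..} (\<lambda>x::real. x * ln x)"
    unfolding continuous_on_def
  proof
    fix x :: real assume "x \<in> {0..}"
    show "((\<lambda>x. x * ln x) \<longlongrightarrow> x * ln x) (at x within {0..})"
    proof (cases "x = 0")
      case True then show ?thesis using * by simp
    next
      case False
      then show ?thesis by (intro tendsto_intros) auto
    qed
  qed
  then have "continuous_on {0..} (\<lambda>x::real. (- 1 / ln 2) * (x * ln x))"
    by (rule continuous_on_mult_left)
  then show ?thesis by (simp add: eta_def[abs_def] log_def)
qed

lemma continuous_on_eta_comp:
  "continuous_on S f \<Longrightarrow> (\<And>x. x \<in> S \<Longrightarrow> 0 \<le> f x) \<Longrightarrow> continuous_on S (\<lambda>x. eta (f x))"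
  by (rule continuous_on_compose2[OF continuous_on_eta]) auto

section \<open>Image laws as finite sums, and the basic entropy inequalities\<close>

lemma pmf_map_sum:
  assumes "finite (set_pmf M)"
  shows "pmf (map_pmf f M) v = (\<Sum>w | w \<in> set_pmf M \<and> f w = v. pmf M w)"
proof -
  have "pmf (map_pmf f M) v = measure M (f -` {v} \<inter> set_pmf M)"
    by (simp add: pmf_map measure_Int_set_pmf)
  also have "f -` {v} \<inter> set_pmf M = {w. w \<in> set_pmf M \<and> f w = v}" by auto
  finally show ?thesis using assms by (simp add: measure_measure_pmf_finite)
qed

lemma sum_pmf_map:
  assumes "finite (set_pmf M)"
  shows "(\<Sum>v\<in>set_pmf (map_pmf f M). pmf (map_pmf f M) v * h v) = (\<Sum>w\<in>set_pmf M. pmf M w * h (f w))"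
proof -
  have "(\<Sum>w\<in>set_pmf M. pmf M w * h (f w))
      = (\<Sum>v\<in>f ` set_pmf M. \<Sum>w | w \<in> set_pmf M \<and> f w = v. pmf M w * h (f w))"
    using assms by (rule sum.image_gen)
  also have "\<dots> = (\<Sum>v\<in>f ` set_pmf M. pmf (map_pmf f M) v * h v)"
    by (intro sum.cong refl) (auto simp: pmf_map_sum[OF assms] sum_distrib_right)
  finally show ?thesis by simp
qed

lemma sum_pmf_map_Pair:
  assumes "finite (set_pmf M)" "finite S" "X ` set_pmf M \<subseteq> S"
  shows "(\<Sum>x\<in>S. pmf (map_pmf (\<lambda>w. (X w, Z w)) M) (x, z)) = pmf (map_pmf Z M) z"
proof -
  have "(\<Sum>x\<in>S. pmf (map_pmf (\<lambda>w. (X w, Z w)) M) (x, z))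
      = (\<Sum>x\<in>S. \<Sum>w | w \<in> {w \<in> set_pmf M. Z w = z} \<and> X w = x. pmf M w)"
    unfolding pmf_map_sum[OF assms(1)] by (intro sum.cong) auto
  also have "\<dots> = (\<Sum>w\<in>{w \<in> set_pmf M. Z w = z}. pmf M w)"
    using assms by (intro sum.group) auto
  finally show ?thesis by (simp add: pmf_map_sum[OF assms(1)])
qed

lemma ent_eq_sum_eta:
  assumes "finite S" "set_pmf (map_pmf X M) \<subseteq> S"
  shows "ent M X = (\<Sum>v\<in>S. eta (pmf (map_pmf X M) v))"
proof -
  have "ent M X = (\<Sum>v\<in>set_pmf (map_pmf X M). eta (pmf (map_pmf X M) v))"
    by (simp add: ent_def eta_def sum_negf)
  also have "\<dots> = (\<Sum>v\<in>S. eta (pmf (map_pmf X M) v))"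
    using assms by (intro sum.mono_neutral_left) (auto simp del: set_map_pmf simp: set_pmf_iff)
  finally show ?thesis .
qed

lemma ent_eq_expectation:
  assumes "finite (set_pmf M)"
  shows "ent M X = - (\<Sum>w\<in>set_pmf M. pmf M w * log 2 (pmf (map_pmf X M) (X w)))"
  unfolding ent_def by (simp only: sum_pmf_map[OF assms])

lemma ent_cong_law: "map_pmf X M = map_pmf Y N \<Longrightarrow> ent M X = ent N Y"
  by (simp add: ent_def)

lemma ent_map_pmf: "ent (map_pmf f M) X = ent M (\<lambda>w. X (f w))"
  by (simp add: ent_def pmf.map_comp o_def)

text \<open>Entropy sees a variable only through the partition it induces on the support: the
  relabelling \<open>g\<close> is injective there. The regrouping of tuples in the telescoping sums
  rests on this.\<close>

lemma ent_cong:
  assumes "\<And>w w'. w \<in> set_pmf M \<Longrightarrow> w' \<in> set_pmf M \<Longrightarrow> X w = X w' \<longleftrightarrow> Y w = Y w'"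
  shows "ent M X = ent M Y"
proof -
  define g where "g x = Y (SOME w. w \<in> set_pmf M \<and> X w = x)" for x
  have g: "g (X w) = Y w" if "w \<in> set_pmf M" for w
  proof -
    have "(SOME w'. w' \<in> set_pmf M \<and> X w' = X w) \<in> set_pmf M \<and>
        X (SOME w'. w' \<in> set_pmf M \<and> X w' = X w) = X w"
      by (rule someI_ex) (use that in auto)
    then show ?thesis using assms that unfolding g_def by metis
  qed
  have inj: "inj_on g (set_pmf (map_pmf X M))"
    using assms by (auto simp: inj_on_def g)
  have eq: "map_pmf Y M = map_pmf g (map_pmf X M)"
    unfolding pmf.map_comp by (intro map_pmf_cong) (auto simp: g)
  show ?thesis
    unfolding ent_def eq set_map_pmf[of g]
    by (subst sum.reindex[OF inj]) (simp add: pmf_map_inj[OF inj])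
qed

text \<open>Gibbs' inequality: \<open>?r\<close> is the ratio
  \<open>p(x,z) p(y,z) / (p(x,y,z) p(z))\<close>, its mean is at most 1, and
  \<open>ln r <= r - 1\<close> is applied pointwise.\<close>

lemma cond_mutual_info_nonneg:
  assumes fin: "finite (set_pmf M)"
  shows "0 \<le> cond_mutual_info M X Y Z"
proof -
  let ?S = "set_pmf M"
  let ?p = "pmf (map_pmf (\<lambda>w. (X w, Y w, Z w)) M)"
  let ?xz = "pmf (map_pmf (\<lambda>w. (X w, Z w)) M)"
  let ?yz = "pmf (map_pmf (\<lambda>w. (Y w, Z w)) M)"
  let ?z = "pmf (map_pmf Z M)"
  let ?r = "\<lambda>(x, y, z). ?xz (x, z) * ?yz (y, z) / (?p (x, y, z) * ?z z)"
  have pos: "?p (X w, Y w, Z w) > 0" "?xz (X w, Z w) > 0" "?yz (Y w, Z w) > 0" "?z (Z w) > 0"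
    if "w \<in> ?S" for w
    using that by (auto intro!: pmf_positive)
  have key: "(1 - ?r (X w, Y w, Z w)) / ln 2 \<le> log 2 (?p (X w, Y w, Z w)) + log 2 (?z (Z w))
       - log 2 (?xz (X w, Z w)) - log 2 (?yz (Y w, Z w))" if "w \<in> ?S" for w
  proof -
    have "ln (?r (X w, Y w, Z w)) \<le> ?r (X w, Y w, Z w) - 1"
      using pos[OF that] by (intro ln_le_minus_one) auto
    moreover have "ln (?r (X w, Y w, Z w)) = ln (?xz (X w, Z w)) + ln (?yz (Y w, Z w))
        - ln (?p (X w, Y w, Z w)) - ln (?z (Z w))"
      using pos[OF that] by (simp add: ln_mult ln_div)
    ultimately have "1 - ?r (X w, Y w, Z w) \<le> ln (?p (X w, Y w, Z w)) + ln (?z (Z w))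
        - ln (?xz (X w, Z w)) - ln (?yz (Y w, Z w))" by linarith
    then show ?thesis
      unfolding log_def by (simp add: divide_right_mono flip: add_divide_distrib diff_divide_distrib)
  qed
  let ?Sx = "X ` ?S" and ?Sy = "Y ` ?S" and ?Sz = "Z ` ?S"
  have "(\<Sum>w\<in>?S. pmf M w * ?r (X w, Y w, Z w))
      = (\<Sum>v\<in>set_pmf (map_pmf (\<lambda>w. (X w, Y w, Z w)) M). ?p v * ?r v)"
    by (simp only: sum_pmf_map[OF fin])
  also have "\<dots> = (\<Sum>(x, y, z)\<in>set_pmf (map_pmf (\<lambda>w. (X w, Y w, Z w)) M). ?xz (x, z) * ?yz (y, z) / ?z z)"
    by (intro sum.cong refl) (use pos in \<open>fastforce simp: field_simps\<close>)
  \<comment> \<open>The mean of \<open>?r\<close> only runs over the support of the triple.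
    Extending it to the full product adds nonnegative terms, and the sum then factors for each
    \<open>z\<close>.\<close>
  also have "\<dots> \<le> (\<Sum>(x, y, z)\<in>?Sx \<times> ?Sy \<times> ?Sz. ?xz (x, z) * ?yz (y, z) / ?z z)"
    using fin by (intro sum_mono2) auto
  also have "\<dots> = (\<Sum>x\<in>?Sx. \<Sum>y\<in>?Sy. \<Sum>z\<in>?Sz. ?xz (x, z) * ?yz (y, z) / ?z z)"
    by (simp add: sum.cartesian_product)
  also have "\<dots> = (\<Sum>x\<in>?Sx. \<Sum>z\<in>?Sz. \<Sum>y\<in>?Sy. ?xz (x, z) * ?yz (y, z) / ?z z)"
    by (intro sum.cong refl sum.swap)
  also have "\<dots> = (\<Sum>z\<in>?Sz. \<Sum>x\<in>?Sx. \<Sum>y\<in>?Sy. ?xz (x, z) * ?yz (y, z) / ?z z)"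
    by (rule sum.swap)
  also have "\<dots> = (\<Sum>z\<in>?Sz. (\<Sum>x\<in>?Sx. ?xz (x, z)) * (\<Sum>y\<in>?Sy. ?yz (y, z)) / ?z z)"
    by (simp add: sum_product sum_divide_distrib)
  also have "\<dots> = (\<Sum>z\<in>?Sz. ?z z)"
    using fin pos(4) by (intro sum.cong refl) (auto simp: sum_pmf_map_Pair dest: less_imp_neq)
  also have "\<dots> = 1"
    using sum_pmf_eq_1[of ?Sz "map_pmf Z M"] fin by simp
  finally have le1: "(\<Sum>w\<in>?S. pmf M w * ?r (X w, Y w, Z w)) \<le> 1" .
  have "0 \<le> (1 - (\<Sum>w\<in>?S. pmf M w * ?r (X w, Y w, Z w))) / ln 2"
    using le1 by simp
  also have "\<dots> = ((\<Sum>w\<in>?S. pmf M w) - (\<Sum>w\<in>?S. pmf M w * ?r (X w, Y w, Z w))) / ln 2"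
    using sum_pmf_eq_1[of ?S M] fin by simp
  also have "\<dots> = (\<Sum>w\<in>?S. pmf M w * ((1 - ?r (X w, Y w, Z w)) / ln 2))"
    by (simp add: sum_subtractf[symmetric] sum_divide_distrib right_diff_distrib)
  also have "\<dots> \<le> (\<Sum>w\<in>?S. pmf M w * (log 2 (?p (X w, Y w, Z w)) + log 2 (?z (Z w))
       - log 2 (?xz (X w, Z w)) - log 2 (?yz (Y w, Z w))))"
    using key by (intro sum_mono mult_left_mono) auto
  also have "\<dots> = cond_mutual_info M X Y Z"
    unfolding cond_mutual_info_def ent_eq_expectation[OF fin]
    by (simp add: algebra_simps sum.distrib sum_subtractf)
  finally show ?thesis .
qed

text \<open>Since \<open>Z\<close> is a function of \<open>Y\<close> on the support, the gap between
  the two sides is \<open>I(X;Y|Z)\<close>.\<close>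

lemma cond_ent_mono:
  assumes fin: "finite (set_pmf M)"
    and det: "\<And>w w'. w \<in> set_pmf M \<Longrightarrow> w' \<in> set_pmf M \<Longrightarrow> Y w = Y w' \<Longrightarrow> Z w = Z w'"
  shows "cond_ent M X Y \<le> cond_ent M X Z"
proof -
  have "ent M (\<lambda>w. (Y w, Z w)) = ent M Y" "ent M (\<lambda>w. (X w, Y w, Z w)) = ent M (\<lambda>w. (X w, Y w))"
    by (rule ent_cong; blast intro: det)+
  then show ?thesis
    using cond_mutual_info_nonneg[OF fin, of X Y Z]
    by (simp add: cond_mutual_info_def cond_ent_def)
qed

lemma ent_const [simp]: "ent M (\<lambda>_. c) = 0"
  by (simp add: ent_def)

lemma cond_ent_le_ent:
  assumes "finite (set_pmf M)"
  shows "cond_ent M X Y \<le> ent M X"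
proof -
  have "cond_ent M X Y \<le> cond_ent M X (\<lambda>_. ())"
    using assms by (intro cond_ent_mono) auto
  also have "\<dots> = ent M X"
    unfolding cond_ent_def by (simp, rule ent_cong) auto
  finally show ?thesis .
qed

section \<open>Markov kernels and concave envelopes\<close>

text \<open>
  The vector \<open>v\<close> need not be normalised: the second term makes the function positively homogeneous,
  so that conditional entropies are sums over the unnormalised rows of a joint law.
\<close>
definition output_ent :: "('a::finite \<Rightarrow> 'c::finite pmf) \<Rightarrow> real ^ 'a \<Rightarrow> real" where
  "output_ent K v = (\<Sum>c\<in>UNIV. eta (\<Sum>a\<in>UNIV. v $ a * pmf (K a) c)) - eta (\<Sum>a\<in>UNIV. v $ a)"

text \<open>The conditional law of \<open>A\<close> given \<open>F = f\<close>, scaled by the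
  probability of \<open>f\<close>. Leaving it unnormalised avoids division by zero and makes the
  rows add up to the law of \<open>A\<close>.\<close>

definition joint_row :: "'w pmf \<Rightarrow> ('w \<Rightarrow> 'f) \<Rightarrow> ('w \<Rightarrow> 'a::finite) \<Rightarrow> 'f \<Rightarrow> real ^ 'a" where
  "joint_row M F A f = (\<chi> a. pmf (map_pmf (\<lambda>w. (F w, A w)) M) (f, a))"

definition law :: "'w pmf \<Rightarrow> ('w \<Rightarrow> 'a::finite) \<Rightarrow> real ^ 'a" where
  "law M A = (\<chi> a. pmf (map_pmf A M) a)"

text \<open>The chain \<open>F - A - C\<close> with kernel \<open>K\<close>, as an equality of laws
  so that it can be established by rewriting with \<open>bind_pmf\<close>.\<close>

definition markov ::
  "'w pmf \<Rightarrow> ('w \<Rightarrow> 'f) \<Rightarrow> ('w \<Rightarrow> 'a) \<Rightarrow> ('w \<Rightarrow> 'c) \<Rightarrow> ('a \<Rightarrow> 'c pmf) \<Rightarrow> bool" where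
  "markov M F A C K \<longleftrightarrow> map_pmf (\<lambda>w. (F w, A w, C w)) M =
     bind_pmf M (\<lambda>w. map_pmf (\<lambda>c. (F w, A w, c)) (K (A w)))"

text \<open>Both outer variables may absorb \<open>A\<close>, which is fixed when \<open>C\<close>
  is drawn. This yields the kernels whose outputs are pairs such as \<open>(A, B)\<close>.\<close>

lemma markov_comp:
  assumes "markov M F A C K"
  shows "markov M (\<lambda>w. g (F w) (A w)) A (\<lambda>w. h (A w) (C w)) (\<lambda>a. map_pmf (h a) (K a))"
proof -
  have "map_pmf (\<lambda>(f, a, c). (g f a, a, h a c)) (map_pmf (\<lambda>w. (F w, A w, C w)) M) =
      map_pmf (\<lambda>(f, a, c). (g f a, a, h a c))
        (bind_pmf M (\<lambda>w. map_pmf (\<lambda>c. (F w, A w, c)) (K (A w))))"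
    using assms by (simp add: markov_def)
  then show ?thesis
    by (simp add: markov_def map_bind_pmf pmf.map_comp o_def)
qed

text \<open>Memorylessness enters here: if redrawing \<open>C\<close> from \<open>K (A w)\<close>
  preserves \<open>M\<close> and disturbs neither \<open>F\<close> nor \<open>A\<close>, then
  \<open>C\<close> depends on \<open>F\<close> only through \<open>A\<close>.\<close>

lemma markov_resample:
  assumes "M = bind_pmf M (\<lambda>w. map_pmf (R w) (K (A w)))"
    and "\<And>w c. w \<in> set_pmf M \<Longrightarrow> F (R w c) = F w \<and> A (R w c) = A w \<and> C (R w c) = c"
  shows "markov M F A C K"
proof -
  have "map_pmf (\<lambda>w. (F w, A w, C w)) M =
      bind_pmf M (\<lambda>w. map_pmf (\<lambda>w. (F w, A w, C w)) (map_pmf (R w) (K (A w))))"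
    by (subst assms(1)) (simp add: map_bind_pmf)
  also have "\<dots> = bind_pmf M (\<lambda>w. map_pmf (\<lambda>c. (F w, A w, c)) (K (A w)))"
    using assms(2) by (intro bind_pmf_cong refl) (simp add: pmf.map_comp o_def)
  finally show ?thesis by (simp add: markov_def)
qed

lemma pmf_markov:
  assumes "markov M F A C K"
  shows "pmf (map_pmf (\<lambda>w. (F w, A w, C w)) M) (f, a, c) =
    pmf (map_pmf (\<lambda>w. (F w, A w)) M) (f, a) * pmf (K a) c"
proof -
  have *: "pmf (map_pmf (\<lambda>c. (F w, A w, c)) (K (A w))) (f, a, c) =
      indicat_real {w. F w = f \<and> A w = a} w * pmf (K a) c" for w
  proof (cases "F w = f \<and> A w = a")
    case True
    then show ?thesis
      using pmf_map_inj'[of "\<lambda>c. (f, a, c)" "K a" c] by (auto simp: inj_on_def)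
  next
    case False
    then show ?thesis by (auto simp: pmf_eq_0_set_pmf)
  qed
  have "{w. F w = f \<and> A w = a} = (\<lambda>w. (F w, A w)) -` {(f, a)}" by auto
  then have "pmf (map_pmf (\<lambda>w. (F w, A w)) M) (f, a) = measure M {w. F w = f \<and> A w = a}"
    by (simp add: pmf_map)
  then show ?thesis
    using assms by (simp add: markov_def pmf_bind *)
qed

lemma sum_joint_row:
  assumes "finite (set_pmf M)" "finite S" "F ` set_pmf M \<subseteq> S"
  shows "(\<Sum>f\<in>S. joint_row M F A f) = law M A"
  unfolding vec_eq_iff joint_row_def law_def
  using sum_pmf_map_Pair[OF assms, of A] by simp

lemma sum_joint_row_component:
  assumes "finite (set_pmf M)"
  shows "(\<Sum>a\<in>UNIV. joint_row M F A f $ a) = pmf (map_pmf F M) f"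
proof -
  have "(\<Sum>a\<in>UNIV. joint_row M F A f $ a) = (\<Sum>a\<in>UNIV. pmf (map_pmf (\<lambda>w. (A w, F w)) M) (a, f))"
    unfolding joint_row_def by (intro sum.cong) (auto simp: pmf_map_sum[OF assms] intro!: sum.cong)
  also have "\<dots> = pmf (map_pmf F M) f"
    using assms by (intro sum_pmf_map_Pair) auto
  finally show ?thesis .
qed

lemma joint_row_nonneg: "0 \<le> joint_row M F A f $ a"
  by (simp add: joint_row_def)

text \<open>Pushing the row of \<open>f\<close> through \<open>K\<close> gives the joint law of
  \<open>C\<close> with the event \<open>F = f\<close>, so the two halves of
  \<open>output_ent\<close> sum to \<open>H(C,F)\<close> and \<open>H(F)\<close>.\<close>

lemma cond_ent_markov:
  fixes A :: "'w \<Rightarrow> 'a::finite" and C :: "'w \<Rightarrow> 'c::finite"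
  assumes fin: "finite (set_pmf M)" and mk: "markov M F A C K"
  shows "cond_ent M C F = (\<Sum>f\<in>F ` set_pmf M. output_ent K (joint_row M F A f))"
proof -
  let ?S = "F ` set_pmf M"
  have P: "pmf (map_pmf (\<lambda>w. (C w, F w)) M) (c, f) = (\<Sum>a\<in>UNIV. joint_row M F A f $ a * pmf (K a) c)" for c f
  proof -
    have "(\<Sum>a\<in>UNIV. joint_row M F A f $ a * pmf (K a) c) =
        (\<Sum>a\<in>UNIV. pmf (map_pmf (\<lambda>w. (A w, (C w, F w))) M) (a, (c, f)))"
    proof (intro sum.cong refl)
      fix a
      have "joint_row M F A f $ a * pmf (K a) c = pmf (map_pmf (\<lambda>w. (F w, A w, C w)) M) (f, a, c)"
        by (simp add: joint_row_def pmf_markov[OF mk])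
      also have "\<dots> = pmf (map_pmf (\<lambda>w. (A w, (C w, F w))) M) (a, (c, f))"
        unfolding pmf_map_sum[OF fin] by (intro sum.cong) auto
      finally show "joint_row M F A f $ a * pmf (K a) c = \<dots>" .
    qed
    also have "\<dots> = pmf (map_pmf (\<lambda>w. (C w, F w)) M) (c, f)"
      using fin by (intro sum_pmf_map_Pair) auto
    finally show ?thesis by simp
  qed
  have "ent M (\<lambda>w. (C w, F w)) = (\<Sum>(c, f)\<in>UNIV \<times> ?S. eta (pmf (map_pmf (\<lambda>w. (C w, F w)) M) (c, f)))"
    using fin by (subst ent_eq_sum_eta[of "UNIV \<times> ?S"]) (auto simp: case_prod_unfold)
  also have "\<dots> = (\<Sum>f\<in>?S. \<Sum>c\<in>UNIV. eta (pmf (map_pmf (\<lambda>w. (C w, F w)) M) (c, f)))"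
    by (subst sum.swap) (simp add: sum.cartesian_product)
  finally have "ent M (\<lambda>w. (C w, F w)) =
      (\<Sum>f\<in>?S. \<Sum>c\<in>UNIV. eta (\<Sum>a\<in>UNIV. joint_row M F A f $ a * pmf (K a) c))"
    by (simp add: P)
  moreover have "ent M F = (\<Sum>f\<in>?S. eta (\<Sum>a\<in>UNIV. joint_row M F A f $ a))"
    using fin by (subst ent_eq_sum_eta[of ?S]) (auto simp: sum_joint_row_component)
  ultimately show ?thesis
    by (simp add: cond_ent_def output_ent_def sum_subtractf)
qed

text \<open>Both halves pick up a multiple of \<open>eta r\<close>, and the multiples agree because
  a kernel preserves total mass (\<open>tot\<close>).\<close>

lemma output_ent_scale:
  assumes "0 \<le> r" "\<And>a. 0 \<le> v $ a"
  shows "output_ent K (r *\<^sub>R v) = r * output_ent K v"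
proof -
  have nn: "0 \<le> (\<Sum>a\<in>UNIV. v $ a * pmf (K a) c)" for c
    using assms by (intro sum_nonneg) auto
  have "(\<Sum>c\<in>UNIV. \<Sum>a\<in>UNIV. v $ a * pmf (K a) c) = (\<Sum>a\<in>UNIV. v $ a * (\<Sum>c\<in>UNIV. pmf (K a) c))"
    by (subst sum.swap) (simp add: sum_distrib_left)
  also have "\<dots> = (\<Sum>a\<in>UNIV. v $ a)"
    by (simp add: sum_pmf_eq_1)
  finally have tot: "(\<Sum>c\<in>UNIV. \<Sum>a\<in>UNIV. v $ a * pmf (K a) c) = (\<Sum>a\<in>UNIV. v $ a)" .
  have "output_ent K (r *\<^sub>R v) = (\<Sum>c\<in>UNIV. eta (r * (\<Sum>a\<in>UNIV. v $ a * pmf (K a) c)))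
      - eta (r * (\<Sum>a\<in>UNIV. v $ a))"
    by (simp add: output_ent_def sum_distrib_left mult.assoc)
  also have "\<dots> = (\<Sum>c\<in>UNIV. r * eta (\<Sum>a\<in>UNIV. v $ a * pmf (K a) c) + (\<Sum>a\<in>UNIV. v $ a * pmf (K a) c) * eta r)
      - (r * eta (\<Sum>a\<in>UNIV. v $ a) + (\<Sum>a\<in>UNIV. v $ a) * eta r)"
    using assms by (simp add: eta_mult nn sum_nonneg)
  also have "\<dots> = r * output_ent K v"
    by (simp add: output_ent_def sum.distrib sum_distrib_left[symmetric] sum_distrib_right[symmetric] tot algebra_simps)
  finally show ?thesis .
qed

text \<open>With \<open>A\<close> among the conditions each row is a multiple of a unit vector, so
  the value is determined by \<open>K\<close> and the law of \<open>A\<close>, whatever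
  \<open>F\<close> is.\<close>

lemma cond_ent_kernel:
  fixes A :: "'w \<Rightarrow> 'a::finite" and C :: "'w \<Rightarrow> 'c::finite"
  assumes fin: "finite (set_pmf M)" and mk: "markov M F A C K"
  shows "cond_ent M C (\<lambda>w. (F w, A w)) = (\<Sum>a\<in>UNIV. pmf (map_pmf A M) a * output_ent K (axis a 1))"
proof -
  let ?F = "\<lambda>w. (F w, A w)"
  have mk': "markov M ?F A C K"
    using markov_comp[OF mk, of Pair "\<lambda>_ c. c"] by simp
  have r: "joint_row M ?F A v = pmf (map_pmf ?F M) v *\<^sub>R axis (snd v) 1" for v
  proof -
    have "pmf (map_pmf (\<lambda>w. ((F w, A w), A w)) M) (v, a) =
        (if a = snd v then pmf (map_pmf ?F M) v else 0)" for a
      unfolding pmf_map_sum[OF fin] by (auto intro!: sum.cong sum.neutral)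
    then show ?thesis by (auto simp: vec_eq_iff joint_row_def axis_def)
  qed
  have "cond_ent M C ?F = (\<Sum>v\<in>set_pmf (map_pmf ?F M). pmf (map_pmf ?F M) v * output_ent K (axis (snd v) 1))"
    unfolding cond_ent_markov[OF fin mk'] r
    by (auto simp: axis_def output_ent_scale intro!: sum.cong)
  also have "\<dots> = (\<Sum>w\<in>set_pmf M. pmf M w * output_ent K (axis (A w) 1))"
    by (simp only: sum_pmf_map[OF fin] snd_conv)
  also have "\<dots> = (\<Sum>a\<in>set_pmf (map_pmf A M). pmf (map_pmf A M) a * output_ent K (axis a 1))"
    by (simp only: sum_pmf_map[OF fin])
  also have "\<dots> = (\<Sum>a\<in>UNIV. pmf (map_pmf A M) a * output_ent K (axis a 1))"
    by (intro sum.mono_neutral_left) (auto simp: pmf_eq_0_set_pmf simp del: set_map_pmf)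
  finally show ?thesis .
qed

lemma ent_markov:
  fixes A :: "'w \<Rightarrow> 'a::finite" and C :: "'w \<Rightarrow> 'c::finite"
  assumes fin: "finite (set_pmf M)" and mk: "markov M F A C K"
  shows "ent M C = output_ent K (law M A)"
proof -
  have "markov M (\<lambda>_. 0 :: nat) A C K"
    using markov_comp[OF mk, of "\<lambda>_ _. 0" "\<lambda>_ c. c"] by simp
  note cond_ent_markov[OF fin this]
  moreover have "(\<Sum>f\<in>{0}. joint_row M (\<lambda>_. 0 :: nat) A f) = law M A"
    by (rule sum_joint_row[OF fin]) auto
  moreover have "(\<lambda>_. 0 :: nat) ` set_pmf M = {0}" using set_pmf_not_empty[of M] by auto
  moreover have "ent M (\<lambda>w. (C w, 0 :: nat)) = ent M C"
    by (rule ent_cong) auto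
  ultimately show ?thesis by (simp add: cond_ent_def)
qed

lemma expectation_markov:
  fixes A :: "'w \<Rightarrow> 'a::finite" and C :: "'w \<Rightarrow> 'c::finite" and \<psi> :: "'f \<Rightarrow> 'a \<Rightarrow> 'c \<Rightarrow> real"
  assumes fin: "finite (set_pmf M)" and mk: "markov M F A C K"
  shows "measure_pmf.expectation M (\<lambda>w. \<psi> (F w) (A w) (C w)) =
    (\<Sum>f\<in>F ` set_pmf M. \<Sum>a\<in>UNIV. \<Sum>c\<in>UNIV. joint_row M F A f $ a * pmf (K a) c * \<psi> f a c)"
proof -
  let ?T = "map_pmf (\<lambda>w. (F w, A w, C w)) M"
  have "measure_pmf.expectation M (\<lambda>w. \<psi> (F w) (A w) (C w)) =
      measure_pmf.expectation ?T (\<lambda>(f, a, c). \<psi> f a c)"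
    by simp
  also have "\<dots> = (\<Sum>v\<in>F ` set_pmf M \<times> UNIV \<times> UNIV. (case v of (f, a, c) \<Rightarrow> \<psi> f a c) * pmf ?T v)"
    using fin by (intro integral_measure_pmf_real) auto
  also have "\<dots> = (\<Sum>(f, a, c)\<in>F ` set_pmf M \<times> UNIV \<times> UNIV. joint_row M F A f $ a * pmf (K a) c * \<psi> f a c)"
    by (intro sum.cong) (auto simp: pmf_markov[OF mk] joint_row_def)
  also have "\<dots> = (\<Sum>f\<in>F ` set_pmf M. \<Sum>a\<in>UNIV. \<Sum>c\<in>UNIV. joint_row M F A f $ a * pmf (K a) c * \<psi> f a c)"
    by (simp add: sum.cartesian_product)
  finally show ?thesis .
qed

section \<open>The simplex, homogeneous functions and convex hulls\<close>

definition prob_simplex :: "(real ^ 'a::finite) set" where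
  "prob_simplex = {v. (\<forall>a. 0 \<le> v $ a) \<and> (\<Sum>a\<in>UNIV. v $ a) = 1}"

lemma compact_prob_simplex: "compact (prob_simplex :: (real ^ 'a::finite) set)"
proof -
  have "closed (prob_simplex :: (real ^ 'a) set)"
    unfolding prob_simplex_def Collect_conj_eq Collect_all_eq
    by (intro closed_Int closed_INT ballI closed_Collect_le closed_Collect_eq continuous_intros)
  moreover have "bounded (prob_simplex :: (real ^ 'a) set)"
  proof (rule boundedI)
    fix v :: "real ^ 'a" assume v: "v \<in> prob_simplex"
    have "norm v \<le> (\<Sum>a\<in>UNIV. \<bar>v $ a\<bar>)" by (rule norm_le_l1_cart)
    also have "\<dots> = 1" using v by (simp add: prob_simplex_def)
    finally show "norm v \<le> 1" .
  qed
  ultimately show ?thesis by (simp add: compact_eq_bounded_closed)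
qed

lemma continuous_on_output_ent: "continuous_on prob_simplex (output_ent K)"
proof -
  have "continuous_on prob_simplex (\<lambda>v. \<Sum>c\<in>UNIV. eta (\<Sum>a\<in>UNIV. v $ a * pmf (K a) c))"
    by (intro continuous_on_sum continuous_on_eta_comp continuous_intros)
       (auto simp: prob_simplex_def intro!: sum_nonneg)
  moreover have "continuous_on prob_simplex (\<lambda>v::real^'a. eta (\<Sum>a\<in>UNIV. v $ a))"
    by (intro continuous_on_eta_comp continuous_intros)
       (auto simp: prob_simplex_def)
  ultimately show ?thesis
    unfolding output_ent_def[abs_def] by (rule continuous_on_diff)
qed

text \<open>On the simplex the mass term is \<open>eta 1 = 0\<close>, which leaves Jensen for
  \<open>eta\<close> at each output letter. It serves to average the channel input laws over the
  positions.\<close>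

lemma output_ent_concave:
  assumes "finite I" "\<And>i. i \<in> I \<Longrightarrow> 0 \<le> c i" "sum c I = 1" "\<And>i. i \<in> I \<Longrightarrow> v i \<in> prob_simplex"
  shows "(\<Sum>i\<in>I. c i * output_ent K (v i)) \<le> output_ent K (\<Sum>i\<in>I. c i *\<^sub>R v i)"
proof -
  have s1: "(\<Sum>a\<in>UNIV. v i $ a) = 1" "\<And>a. 0 \<le> v i $ a" if "i \<in> I" for i
    using assms(4)[OF that] by (auto simp: prob_simplex_def)
  have "(\<Sum>a\<in>UNIV. \<Sum>i\<in>I. c i * v i $ a) = (\<Sum>i\<in>I. c i * (\<Sum>a\<in>UNIV. v i $ a))"
    by (subst sum.swap) (simp add: sum_distrib_left)
  then have tot: "(\<Sum>a\<in>UNIV. \<Sum>i\<in>I. c i * v i $ a) = 1"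
    using assms s1 by simp
  have lin: "(\<Sum>a\<in>UNIV. (\<Sum>i\<in>I. c i * v i $ a) * pmf (K a) x) = (\<Sum>i\<in>I. c i * (\<Sum>a\<in>UNIV. v i $ a * pmf (K a) x))" for x
    unfolding sum_distrib_left sum_distrib_right mult.assoc by (rule sum.swap)
  have "(\<Sum>i\<in>I. c i * output_ent K (v i)) = (\<Sum>i\<in>I. \<Sum>x\<in>UNIV. c i * eta (\<Sum>a\<in>UNIV. v i $ a * pmf (K a) x))"
    using s1 by (intro sum.cong) (auto simp: output_ent_def sum_distrib_left)
  also have "\<dots> = (\<Sum>x\<in>UNIV. \<Sum>i\<in>I. c i * eta (\<Sum>a\<in>UNIV. v i $ a * pmf (K a) x))"
    by (rule sum.swap)
  also have "\<dots> \<le> (\<Sum>x\<in>UNIV. eta (\<Sum>i\<in>I. c i * (\<Sum>a\<in>UNIV. v i $ a * pmf (K a) x)))"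
    using assms s1 by (intro sum_mono eta_concave) (auto intro!: sum_nonneg)
  also have "\<dots> = output_ent K (\<Sum>i\<in>I. c i *\<^sub>R v i)"
    by (simp add: output_ent_def tot lin)
  finally show ?thesis .
qed

text \<open>Restricted to the nonnegative orthant, where \<open>eta_mult\<close> applies.\<close>

definition homogeneous :: "(real ^ 'a \<Rightarrow> 'v::real_vector) \<Rightarrow> bool" where
  "homogeneous G \<longleftrightarrow> (\<forall>r v. 0 \<le> r \<longrightarrow> (\<forall>a. 0 \<le> v $ a) \<longrightarrow> G (r *\<^sub>R v) = r *\<^sub>R G v)"

lemma homogeneous_output_ent: "homogeneous (output_ent K)"
  by (simp add: homogeneous_def output_ent_scale)

lemma homogeneous_Pair: "homogeneous G \<Longrightarrow> homogeneous H \<Longrightarrow> homogeneous (\<lambda>v. (G v, H v))"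
  by (simp add: homogeneous_def)

lemma homogeneous_diff: "homogeneous G \<Longrightarrow> homogeneous H \<Longrightarrow> homogeneous (\<lambda>v. G v - H v)"
  by (simp add: homogeneous_def scaleR_diff_right)

text \<open>Dividing \<open>r i\<close> by its mass \<open>s i\<close> gives a point of the simplex,
  and homogeneity turns the sum into a convex combination with weights \<open>s i / t\<close>. The
  function may vary with \<open>i\<close>, as the reconstruction rule varies with the value of
  \<open>V\<close>.\<close>

lemma normalised_sum_in_convex_hull:
  fixes r :: "'i \<Rightarrow> real ^ 'a::finite" and G :: "'i \<Rightarrow> real ^ 'a \<Rightarrow> 'v::real_vector"
  assumes fin: "finite I" and nn: "\<And>i a. i \<in> I \<Longrightarrow> 0 \<le> r i $ a"
    and t: "t = (\<Sum>i\<in>I. \<Sum>a\<in>UNIV. r i $ a)" "t > 0"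
    and hom: "\<And>i. i \<in> I \<Longrightarrow> homogeneous (G i)"
    and S: "\<And>i v. i \<in> I \<Longrightarrow> v \<in> prob_simplex \<Longrightarrow> (v, G i v) \<in> S"
  shows "(1 / t) *\<^sub>R (\<Sum>i\<in>I. r i, \<Sum>i\<in>I. G i (r i)) \<in> convex hull S"
proof -
  define s where "s i = (\<Sum>a\<in>UNIV. r i $ a)" for i
  have s0: "s i \<ge> 0" if "i \<in> I" for i using nn[OF that] by (auto simp: s_def intro!: sum_nonneg)
  let ?J = "{i\<in>I. s i > 0}"
  let ?y = "\<lambda>i. (r i /\<^sub>R s i, G i (r i /\<^sub>R s i))"
  have z: "r i = 0" "G i (r i) = 0" if "i \<in> I" "\<not> s i > 0" for i
  proof -
    have "s i = 0" using that s0 by fastforce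
    then show "r i = 0" using nn[OF that(1)] unfolding s_def vec_eq_iff
      by (subst (asm) sum_nonneg_eq_0_iff) auto
    moreover have "G i (0 *\<^sub>R 0) = 0 *\<^sub>R G i 0"
      using hom[OF that(1)] unfolding homogeneous_def by (metis order_refl zero_index)
    ultimately show "G i (r i) = 0" by simp
  qed
  have "(\<Sum>i\<in>?J. (s i / t) *\<^sub>R ?y i) \<in> convex hull S"
  proof (rule convex_sum)
    have "sum s ?J = sum s I"
      using fin s0 by (intro sum.mono_neutral_left) (auto simp: antisym not_less)
    then show "(\<Sum>i\<in>?J. s i / t) = 1"
      using t by (simp add: s_def sum_divide_distrib[symmetric])
    fix i assume i: "i \<in> ?J"
    then have "(\<Sum>a\<in>UNIV. inverse (s i) * r i $ a) = 1"
      by (simp add: sum_distrib_left[symmetric] s_def[symmetric])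
    then have "r i /\<^sub>R s i \<in> prob_simplex"
      using i nn by (auto simp: prob_simplex_def)
    then show "?y i \<in> convex hull S" using i S by (auto intro: hull_inc)
    show "s i / t \<ge> 0" using i t by auto
  qed (use fin in auto)
  also have "(\<Sum>i\<in>?J. (s i / t) *\<^sub>R ?y i) = (\<Sum>i\<in>?J. (1 / t) *\<^sub>R (r i, G i (r i)))"
  proof (intro sum.cong refl)
    fix i assume i: "i \<in> ?J"
    then have "G i (s i *\<^sub>R (r i /\<^sub>R s i)) = s i *\<^sub>R G i (r i /\<^sub>R s i)"
      using hom[of i] nn[of i] by (simp only: homogeneous_def) auto
    then have "G i (r i) = s i *\<^sub>R G i (r i /\<^sub>R s i)" using i by simp
    then show "(s i / t) *\<^sub>R ?y i = (1 / t) *\<^sub>R (r i, G i (r i))"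
      using i by (simp add: divide_inverse mult.commute)
  qed
  also have "\<dots> = (\<Sum>i\<in>I. (1 / t) *\<^sub>R (r i, G i (r i)))"
    using fin z by (intro sum.mono_neutral_left) (auto simp: zero_prod_def)
  also have "\<dots> = (1 / t) *\<^sub>R (\<Sum>i\<in>I. r i, \<Sum>i\<in>I. G i (r i))"
    by (simp add: scaleR_sum_right[symmetric] sum_prod)
  finally show ?thesis .
qed

lemma rows_in_convex_hull:
  fixes A :: "'w \<Rightarrow> 'a::finite" and G :: "'f \<Rightarrow> real ^ 'a \<Rightarrow> 'v::real_vector"
  assumes fin: "finite (set_pmf M)"
    and hom: "\<And>f. homogeneous (G f)"
    and S: "\<And>f v. v \<in> prob_simplex \<Longrightarrow> (v, G f v) \<in> S"
  shows "(law M A, \<Sum>f\<in>F ` set_pmf M. G f (joint_row M F A f)) \<in> convex hull S"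
proof -
  have "(\<Sum>f\<in>F ` set_pmf M. \<Sum>a\<in>UNIV. joint_row M F A f $ a) = 1"
    using sum_pmf_eq_1[of "F ` set_pmf M" "map_pmf F M"] fin by (simp add: sum_joint_row_component)
  then have "(1 / 1) *\<^sub>R (\<Sum>f\<in>F ` set_pmf M. joint_row M F A f, \<Sum>f\<in>F ` set_pmf M. G f (joint_row M F A f))
      \<in> convex hull S"
    using assms by (intro normalised_sum_in_convex_hull) (auto simp: joint_row_nonneg)
  then show ?thesis using fin by (simp add: sum_joint_row)
qed

section \<open>Memoryless sources and channels\<close>

lemma pmf_disintegrate:
  fixes N :: "('i \<times> 'a) pmf"
  obtains K where "N = bind_pmf (map_pmf snd N) (\<lambda>a. map_pmf (\<lambda>i. (i, a)) (K a))"
    and "finite (set_pmf N) \<Longrightarrow> (\<And>a. finite (set_pmf (K a)))"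
proof
  let ?C = "\<lambda>a. cond_pmf N {y. a = snd y}"
  \<comment> \<open>Off the support any law would do; a point mass keeps every \<open>K a\<close>
    finitely supported.\<close>
  define K where "K a = (if a \<in> snd ` set_pmf N then map_pmf fst (?C a) else return_pmf undefined)" for a
  have ne: "set_pmf N \<inter> {y. a = snd y} \<noteq> {}" if "a \<in> snd ` set_pmf N" for a
    using that by auto
  have *: "map_pmf (\<lambda>i. (i, a)) (K a) = ?C a" if "a \<in> snd ` set_pmf N" for a
  proof -
    have "map_pmf (\<lambda>y. (fst y, a)) (?C a) = map_pmf (\<lambda>y. y) (?C a)"
      by (intro map_pmf_cong refl) (auto simp: set_cond_pmf[OF ne[OF that]])
    then show ?thesis using that by (simp add: K_def pmf.map_comp o_def)
  qed
  have "bind_pmf (map_pmf snd N) ?C = N"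
  proof (rule bind_cond_pmf_cancel)
    fix a y assume "a \<in> set_pmf (map_pmf snd N)" "y \<in> set_pmf N" "a = snd y"
    show "measure N {y. a = snd y} = measure (map_pmf snd N) {a. a = snd y}"
      using \<open>a = snd y\<close> by (simp add: measure_map_pmf vimage_def eq_commute)
  qed auto
  moreover have "bind_pmf (map_pmf snd N) (\<lambda>a. map_pmf (\<lambda>i. (i, a)) (K a)) = bind_pmf (map_pmf snd N) ?C"
    by (intro bind_pmf_cong refl) (simp add: *)
  ultimately show "N = bind_pmf (map_pmf snd N) (\<lambda>a. map_pmf (\<lambda>i. (i, a)) (K a))"
    by simp
  show "finite (set_pmf (K a))" if "finite (set_pmf N)" for a
    using that by (auto simp: K_def set_cond_pmf[OF ne])
qed

text \<open>At the head, the fresh draw is moved past the tail by \<open>bind_commute_pmf\<close>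
  and absorbed by the fixed-point equation for \<open>p\<close>; later positions follow by
  induction.\<close>

lemma iid_pmf_resample:
  assumes p: "p = bind_pmf p (\<lambda>s. map_pmf (R s) (K (g s)))" and "i < n"
  shows "iid_pmf n p = bind_pmf (iid_pmf n p) (\<lambda>s. map_pmf (\<lambda>c. s[i := R (s ! i) c]) (K (g (s ! i))))"
  using \<open>i < n\<close>
proof (induction n arbitrary: i)
  case (Suc n)
  show ?case
  proof (cases i)
    case 0
    have "bind_pmf (iid_pmf (Suc n) p) (\<lambda>s. map_pmf (\<lambda>c. s[i := R (s ! i) c]) (K (g (s ! i))))
      = bind_pmf p (\<lambda>s. bind_pmf (iid_pmf n p) (\<lambda>ss. bind_pmf (map_pmf (R s) (K (g s))) (\<lambda>s'. return_pmf (s' # ss))))"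
      by (simp add: 0 bind_assoc_pmf bind_map_pmf map_pmf_def bind_return_pmf)
    also have "\<dots> = bind_pmf p (\<lambda>s. bind_pmf (map_pmf (R s) (K (g s))) (\<lambda>s'. bind_pmf (iid_pmf n p) (\<lambda>ss. return_pmf (s' # ss))))"
      by (subst bind_commute_pmf) simp
    also have "\<dots> = bind_pmf (bind_pmf p (\<lambda>s. map_pmf (R s) (K (g s)))) (\<lambda>s'. bind_pmf (iid_pmf n p) (\<lambda>ss. return_pmf (s' # ss)))"
      by (simp add: bind_assoc_pmf)
    also have "\<dots> = iid_pmf (Suc n) p"
      unfolding p[symmetric] by (simp add: map_pmf_def)
    finally show ?thesis by simp
  next
    case (Suc j)
    with Suc.prems have "j < n" by simp
    have "bind_pmf (iid_pmf (Suc n) p) (\<lambda>s. map_pmf (\<lambda>c. s[i := R (s ! i) c]) (K (g (s ! i))))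
      = bind_pmf p (\<lambda>s. map_pmf ((#) s) (bind_pmf (iid_pmf n p) (\<lambda>s. map_pmf (\<lambda>c. s[j := R (s ! j) c]) (K (g (s ! j))))))"
      by (simp add: Suc bind_assoc_pmf bind_map_pmf map_pmf_def bind_return_pmf)
    also have "\<dots> = iid_pmf (Suc n) p"
      by (simp add: Suc.IH[OF \<open>j < n\<close>, symmetric])
    finally show ?thesis by simp
  qed
qed simp

lemma chan_seq_resample:
  assumes "j < length xs"
  shows "chan_seq W xs = bind_pmf (chan_seq W xs) (\<lambda>r. map_pmf (\<lambda>c. r[j := c]) (W (xs ! j)))"
  using assms
proof (induction xs arbitrary: j)
  case (Cons x xs)
  show ?case
  proof (cases j)
    case 0
    have "bind_pmf (chan_seq W (x # xs)) (\<lambda>r. map_pmf (\<lambda>c. r[j := c]) (W ((x # xs) ! j)))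
      = bind_pmf (W x) (\<lambda>_. bind_pmf (chan_seq W xs) (\<lambda>rs. bind_pmf (W x) (\<lambda>c. return_pmf (c # rs))))"
      by (simp add: 0 bind_assoc_pmf bind_map_pmf map_pmf_def bind_return_pmf)
    also have "\<dots> = chan_seq W (x # xs)"
      by (simp add: map_pmf_def) (rule bind_commute_pmf)
    finally show ?thesis by simp
  next
    case (Suc i)
    with Cons.prems have "i < length xs" by simp
    have "bind_pmf (chan_seq W (x # xs)) (\<lambda>r. map_pmf (\<lambda>c. r[j := c]) (W ((x # xs) ! j)))
      = bind_pmf (W x) (\<lambda>s. map_pmf ((#) s) (bind_pmf (chan_seq W xs) (\<lambda>r. map_pmf (\<lambda>c. r[i := c]) (W (xs ! i)))))"
      by (simp add: Suc bind_assoc_pmf bind_map_pmf map_pmf_def bind_return_pmf)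
    also have "\<dots> = chan_seq W (x # xs)"
      by (simp add: Cons.IH[OF \<open>i < length xs\<close>, symmetric])
    finally show ?thesis by simp
  qed
qed simp

lemma length_iid_pmf: "s \<in> set_pmf (iid_pmf n p) \<Longrightarrow> length s = n"
  by (induction n arbitrary: s) auto

lemma length_chan_seq: "r \<in> set_pmf (chan_seq W xs) \<Longrightarrow> length r = length xs"
  by (induction xs arbitrary: r) auto

lemma map_iid_pmf: "map_pmf (map f) (iid_pmf n p) = iid_pmf n (map_pmf f p)"
proof (induction n)
  case (Suc n)
  show ?case
    by (simp add: map_bind_pmf bind_map_pmf pmf.map_comp o_def Suc.IH[symmetric])
qed simp

lemma nth_iid_pmf: "i < n \<Longrightarrow> map_pmf (\<lambda>s. s ! i) (iid_pmf n p) = p"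
proof (induction n arbitrary: i)
  case (Suc n)
  then show ?case
    by (cases i) (simp_all add: map_bind_pmf pmf.map_comp o_def map_pmf_const bind_return_pmf')
qed simp

text \<open>Chain rule: the new letter is a kernel output from the one-point space, so by
  \<open>cond_ent_kernel\<close> conditioning on the other letters leaves its entropy
  unchanged.\<close>

lemma ent_iid_pmf:
  fixes q :: "'c::finite pmf"
  shows "ent (iid_pmf n q) (\<lambda>s. s) = real n * ent q (\<lambda>s. s)"
proof (induction n)
  case 0
  then show ?case by (simp add: ent_def)
next
  case (Suc n)
  let ?M = "pair_pmf (iid_pmf n q) q"
  have fin: "finite (set_pmf (iid_pmf n q))"
    by (rule finite_subset[OF _ finite_lists_length_eq[of UNIV n]]) (auto dest: length_iid_pmf)
  have eq: "iid_pmf (Suc n) q = map_pmf (\<lambda>(ss, s). s # ss) ?M"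
    by (simp add: pair_pmf_def map_bind_pmf map_pmf_def[of "\<lambda>ss. _ # ss"] bind_return_pmf)
      (rule bind_commute_pmf)
  have "markov ?M fst (\<lambda>_. ()) snd (\<lambda>_. q)"
    by (auto simp: markov_def pair_pmf_def map_bind_pmf bind_assoc_pmf bind_return_pmf map_pmf_def)
  then have "cond_ent ?M snd (\<lambda>w. (fst w, ())) = output_ent (\<lambda>_. q) (axis () 1)"
    using fin by (subst cond_ent_kernel) (auto simp: UNIV_unit)
  moreover have "markov q (\<lambda>_. ()) (\<lambda>_. ()) (\<lambda>s. s) (\<lambda>_. q)"
    by (auto simp: markov_def bind_return_pmf map_pmf_const)
  then have "cond_ent q (\<lambda>s. s) (\<lambda>w. ((), ())) = output_ent (\<lambda>_. q) (axis () 1)"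
    by (subst cond_ent_kernel) (auto simp: UNIV_unit)
  ultimately have "ent ?M (\<lambda>w. (snd w, fst w, ())) - ent ?M (\<lambda>w. (fst w, ())) = ent q (\<lambda>s. (s, (), ()))"
    by (simp add: cond_ent_def)
  moreover have "ent ?M (\<lambda>w. (snd w, fst w, ())) = ent ?M (\<lambda>(ss, s). s # ss)"
    "ent ?M (\<lambda>w. (fst w, ())) = ent ?M fst" "ent q (\<lambda>s. (s, (), ())) = ent q (\<lambda>s. s)"
    by (rule ent_cong; auto)+
  moreover have "ent ?M fst = ent (iid_pmf n q) (\<lambda>s. s)"
    by (rule ent_cong_law) (simp add: map_fst_pair_pmf)
  ultimately show ?case
    by (simp only: eq ent_map_pmf Suc.IH) (simp add: case_prod_unfold algebra_simps)
qed

lemma ent_iid_pmf_map: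
  fixes f :: "'s \<Rightarrow> 'c::finite"
  shows "ent (iid_pmf n p) (map f) = real n * ent p f"
  using ent_iid_pmf[of n "map_pmf f p"] by (simp add: map_iid_pmf[symmetric] ent_map_pmf)

section \<open>Single-letterisation of a code\<close>

lemma take_Suc_eq_iff:
  assumes "i < length xs" "length ys = length xs"
  shows "take (Suc i) xs = take (Suc i) ys \<longleftrightarrow> take i xs = take i ys \<and> xs ! i = ys ! i"
  using assms by (auto simp: take_Suc_conv_app_nth)

lemma drop_eq_iff:
  assumes "i < length xs" "length ys = length xs"
  shows "drop i xs = drop i ys \<longleftrightarrow> xs ! i = ys ! i \<and> drop (Suc i) xs = drop (Suc i) ys"
  using assms by (simp add: Cons_nth_drop_Suc[symmetric])

lemma list_eq_iff_split:
  assumes "i < length xs" "length ys = length xs"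
  shows "xs = ys \<longleftrightarrow> take i xs = take i ys \<and> xs ! i = ys ! i \<and> drop (Suc i) xs = drop (Suc i) ys"
  using assms id_take_nth_drop[of i xs] id_take_nth_drop[of i ys] by metis

definition As where "As w = map fst (fst w)"
definition Bs where "Bs w = map (fst \<circ> snd) (fst w)"
definition Es where "Es w = map (snd \<circ> snd) (fst w)"
definition Xs where "Xs w = fst (snd w)"
definition Ys where "Ys w = map fst (snd (snd w))"
definition Zs where "Zs w = map snd (snd (snd w))"

text \<open>The assumption \<open>kernel\<close> makes \<open>K\<close> a version of the conditional
  law of \<open>(B, E)\<close> given \<open>A\<close>.\<close>

locale wiretap_code =
  fixes p :: "('a::finite \<times> 'b::finite \<times> 'e::finite) pmf"
    and W :: "'x::finite \<Rightarrow> ('y::finite \<times> 'z::finite) pmf"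
    and n m :: nat and enc :: "'a list \<Rightarrow> 'x list pmf"
    and K :: "'a \<Rightarrow> ('b \<times> 'e) pmf"
  assumes kernel: "p = bind_pmf p (\<lambda>s. map_pmf (Pair (fst s)) (K (fst s)))"
    and length_enc: "\<And>as xs. length as = n \<Longrightarrow> xs \<in> set_pmf (enc as) \<Longrightarrow> length xs = m"
begin

abbreviation M where "M \<equiv> code_joint p W n enc"

lemma set_M: "w \<in> set_pmf M \<Longrightarrow> length (fst w) = n \<and> length (Xs w) = m \<and> length (snd (snd w)) = m"
proof -
  assume "w \<in> set_pmf M"
  then obtain s xs yz where w: "w = (s, xs, yz)" "s \<in> set_pmf (iid_pmf n p)"
    "xs \<in> set_pmf (enc (map fst s))" "yz \<in> set_pmf (chan_seq W xs)"
    by (auto simp: code_joint_def)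
  moreover have "length s = n" using w(2) by (rule length_iid_pmf)
  ultimately show ?thesis
    using length_enc[of "map fst s" xs] length_chan_seq[of yz W xs] by (simp add: Xs_def)
qed

lemma length_seqs [simp]:
  assumes "w \<in> set_pmf M"
  shows "length (As w) = n" "length (Bs w) = n" "length (Es w) = n"
    "length (Xs w) = m" "length (Ys w) = m" "length (Zs w) = m"
  using set_M[OF assms] by (auto simp: As_def Bs_def Es_def Ys_def Zs_def)

lemma finite_M: "finite (set_pmf M)"
proof (rule finite_subset)
  show "set_pmf M \<subseteq> {s. set s \<subseteq> UNIV \<and> length s = n} \<times> {s. set s \<subseteq> UNIV \<and> length s = m} \<times> {s. set s \<subseteq> UNIV \<and> length s = m}"
    using set_M by (force simp: Xs_def)
qed (intro finite_cartesian_product finite_lists_length_eq finite)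

text \<open>The encoder reads only the \<open>A\<close> letters, which the update leaves alone.
  Hence the redraw commutes back past the channel and the encoder to the source, where
  \<open>iid_pmf_resample\<close> absorbs it.\<close>

lemma resample_source:
  assumes "i < n"
  shows "M = bind_pmf M (\<lambda>w. map_pmf (\<lambda>c. ((fst w)[i := (As w ! i, c)], snd w)) (K (As w ! i)))"
proof -
  define H where "H s = bind_pmf (enc (map fst s)) (\<lambda>xs. map_pmf (\<lambda>yz. (s, xs, yz)) (chan_seq W xs))" for s :: "('a \<times> 'b \<times> 'e) list"
  let ?f = "\<lambda>s c. s[i := (fst (s ! i), c)]"
  have "bind_pmf M (\<lambda>w. map_pmf (\<lambda>c. ((fst w)[i := (As w ! i, c)], snd w)) (K (As w ! i)))
     = bind_pmf (iid_pmf n p) (\<lambda>s. bind_pmf (enc (map fst s)) (\<lambda>xs. bind_pmf (chan_seq W xs) (\<lambda>yz.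
         bind_pmf (K (map fst s ! i)) (\<lambda>c. return_pmf (s[i := (map fst s ! i, c)], xs, yz)))))"
    by (simp add: code_joint_def bind_assoc_pmf bind_map_pmf map_pmf_def bind_return_pmf As_def)
  also have "\<dots> = bind_pmf (iid_pmf n p) (\<lambda>s. bind_pmf (enc (map fst s)) (\<lambda>xs.
         bind_pmf (K (map fst s ! i)) (\<lambda>c. bind_pmf (chan_seq W xs) (\<lambda>yz. return_pmf (s[i := (map fst s ! i, c)], xs, yz)))))"
    by (subst bind_commute_pmf) simp
  also have "\<dots> = bind_pmf (iid_pmf n p) (\<lambda>s. bind_pmf (K (map fst s ! i)) (\<lambda>c. bind_pmf (enc (map fst s)) (\<lambda>xs.
         bind_pmf (chan_seq W xs) (\<lambda>yz. return_pmf (s[i := (map fst s ! i, c)], xs, yz)))))"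
    by (subst bind_commute_pmf) simp
  also have "\<dots> = bind_pmf (iid_pmf n p) (\<lambda>s. bind_pmf (map_pmf (?f s) (K (fst (s ! i)))) H)"
  proof (intro bind_pmf_cong refl)
    fix s assume "s \<in> set_pmf (iid_pmf n p)"
    then have len: "i < length s" using assms by (simp add: length_iid_pmf)
    then have "map fst (s[i := (fst (s ! i), c)]) = map fst s" for c :: "'b \<times> 'e"
      by (simp add: map_update list_update_same_conv)
    then show "bind_pmf (K (map fst s ! i)) (\<lambda>c. bind_pmf (enc (map fst s)) (\<lambda>xs.
         bind_pmf (chan_seq W xs) (\<lambda>yz. return_pmf (s[i := (map fst s ! i, c)], xs, yz))))
       = bind_pmf (map_pmf (?f s) (K (fst (s ! i)))) H"
      using len by (simp add: H_def bind_map_pmf map_pmf_def bind_assoc_pmf bind_return_pmf)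
  qed
  also have "\<dots> = bind_pmf (iid_pmf n p) H"
    using iid_pmf_resample[where R = "\<lambda>s. Pair (fst s)" and K = K and g = fst, OF kernel assms] by (simp add: bind_assoc_pmf[symmetric])
  also have "\<dots> = M" by (simp add: code_joint_def H_def[abs_def])
  finally show ?thesis by simp
qed

lemma resample_channel:
  assumes "j < m"
  shows "M = bind_pmf M (\<lambda>w. map_pmf (\<lambda>c. (fst w, fst (snd w), (snd (snd w))[j := c])) (W (Xs w ! j)))"
proof -
  have "bind_pmf M (\<lambda>w. map_pmf (\<lambda>c. (fst w, fst (snd w), (snd (snd w))[j := c])) (W (Xs w ! j)))
     = bind_pmf (iid_pmf n p) (\<lambda>s. bind_pmf (enc (map fst s)) (\<lambda>xs. map_pmf (\<lambda>yz. (s, xs, yz))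
         (bind_pmf (chan_seq W xs) (\<lambda>r. map_pmf (\<lambda>c. r[j := c]) (W (xs ! j))))))"
    by (simp add: code_joint_def bind_assoc_pmf bind_map_pmf map_pmf_def bind_return_pmf Xs_def)
  also have "\<dots> = M"
    unfolding code_joint_def
  proof (intro bind_pmf_cong refl)
    fix s xs assume "s \<in> set_pmf (iid_pmf n p)" "xs \<in> set_pmf (enc (map fst s))"
    then have "j < length xs" using assms length_enc[of "map fst s" xs] by (simp add: length_iid_pmf)
    from chan_seq_resample[OF this, of W]
    show "map_pmf (\<lambda>yz. (s, xs, yz)) (bind_pmf (chan_seq W xs) (\<lambda>r. map_pmf (\<lambda>c. r[j := c]) (W (xs ! j))))
        = map_pmf (\<lambda>yz. (s, xs, yz)) (chan_seq W xs)"
      by simp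
  qed
  finally show ?thesis by simp
qed

text \<open>\<open>F\<close> may read anything except the pair \<open>(B_i, E_i)\<close>, including
  the channel words, which do depend on \<open>A_i\<close>.\<close>

lemma markov_source:
  assumes i: "i < n"
    and F: "\<And>s c r. length s = n \<Longrightarrow> F (s[i := (fst (s ! i), c)], r) = F (s, r)"
  shows "markov M F (\<lambda>w. As w ! i) (\<lambda>w. (Bs w ! i, Es w ! i)) K"
proof (rule markov_resample[where R = "\<lambda>w c. ((fst w)[i := (As w ! i, c)], snd w)"])
  show "M = bind_pmf M (\<lambda>w. map_pmf (\<lambda>c. ((fst w)[i := (As w ! i, c)], snd w)) (K (As w ! i)))"
    by (rule resample_source[OF i])
  fix w c assume "w \<in> set_pmf M"
  then have len: "length (fst w) = n" using set_M by auto
  then have "As w ! i = fst (fst w ! i)" using i by (simp add: As_def)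
  then show "F ((fst w)[i := (As w ! i, c)], snd w) = F w \<and>
      As ((fst w)[i := (As w ! i, c)], snd w) ! i = As w ! i \<and>
      (Bs ((fst w)[i := (As w ! i, c)], snd w) ! i, Es ((fst w)[i := (As w ! i, c)], snd w) ! i) = c"
    using F[OF len, of c "snd w"] len i by (simp add: As_def Bs_def Es_def)
qed

lemma markov_channel:
  assumes j: "j < m"
    and F: "\<And>s xs yz c. length yz = m \<Longrightarrow> F (s, xs, yz[j := c]) = F (s, xs, yz)"
  shows "markov M F (\<lambda>w. Xs w ! j) (\<lambda>w. (Ys w ! j, Zs w ! j)) W"
proof (rule markov_resample[where R = "\<lambda>w c. (fst w, fst (snd w), (snd (snd w))[j := c])"])
  show "M = bind_pmf M (\<lambda>w. map_pmf (\<lambda>c. (fst w, fst (snd w), (snd (snd w))[j := c])) (W (Xs w ! j)))"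
    by (rule resample_channel[OF j])
  fix w c assume "w \<in> set_pmf M"
  then have len: "length (snd (snd w)) = m" using set_M by auto
  then show "F (fst w, fst (snd w), (snd (snd w))[j := c]) = F w \<and>
      Xs (fst w, fst (snd w), (snd (snd w))[j := c]) ! j = Xs w ! j \<and>
      (Ys (fst w, fst (snd w), (snd (snd w))[j := c]) ! j, Zs (fst w, fst (snd w), (snd (snd w))[j := c]) ! j) = c"
    using F[OF len] j by (simp add: Xs_def Ys_def Zs_def)
qed

lemma map_fst_M: "map_pmf fst M = iid_pmf n p"
  by (simp add: code_joint_def map_bind_pmf pmf.map_comp o_def map_pmf_const bind_return_pmf')

lemma nth_As: "i < n \<Longrightarrow> map_pmf (\<lambda>w. As w ! i) M = map_pmf fst p"
proof -
  assume i: "i < n"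
  have "map_pmf (\<lambda>w. As w ! i) M = map_pmf fst (map_pmf (\<lambda>s. s ! i) (map_pmf fst M))"
    unfolding pmf.map_comp using i set_M by (intro map_pmf_cong) (auto simp: As_def)
  then show ?thesis using i by (simp add: map_fst_M nth_iid_pmf)
qed

text \<open>This is \<open>H(E|A) - H(B|A)\<close> for one source letter, the price of trading
  \<open>E_i\<close> for \<open>B_i\<close>.\<close>

definition noise_gap :: real where
  "noise_gap = (\<Sum>a\<in>UNIV. pmf (map_pmf fst p) a * output_ent (\<lambda>a. map_pmf snd (K a)) (axis a 1))
       - (\<Sum>a\<in>UNIV. pmf (map_pmf fst p) a * output_ent (\<lambda>a. map_pmf fst (K a)) (axis a 1))"

text \<open>Given \<open>A_i\<close>, neither \<open>B_i\<close> nor \<open>E_i\<close> depends on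
  \<open>F\<close>, so the exchange costs the same constant in every context.\<close>

lemma ent_exchange:
  assumes i: "i < n"
    and F: "\<And>s c r. length s = n \<Longrightarrow> F (s[i := (fst (s ! i), c)], r) = F (s, r)"
  shows "ent M (\<lambda>w. (Es w ! i, F w, As w ! i)) - ent M (\<lambda>w. (Bs w ! i, F w, As w ! i)) = noise_gap"
proof -
  note mk = markov_source[OF i, of F, OF F]
  have "markov M F (\<lambda>w. As w ! i) (\<lambda>w. Es w ! i) (\<lambda>a. map_pmf snd (K a))"
    using markov_comp[OF mk, of "\<lambda>f _. f" "\<lambda>_ c. snd c"] by simp
  moreover have "markov M F (\<lambda>w. As w ! i) (\<lambda>w. Bs w ! i) (\<lambda>a. map_pmf fst (K a))"
    using markov_comp[OF mk, of "\<lambda>f _. f" "\<lambda>_ c. fst c"] by simp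
  ultimately have "cond_ent M (\<lambda>w. Es w ! i) (\<lambda>w. (F w, As w ! i)) - cond_ent M (\<lambda>w. Bs w ! i) (\<lambda>w. (F w, As w ! i)) = noise_gap"
    using finite_M nth_As[OF i] by (simp only: cond_ent_kernel noise_gap_def)
  then show ?thesis by (simp add: cond_ent_def)
qed

text \<open>Positions count from 0 and each variable omits its own: \<open>drop (Suc i)\<close> is
  the strict future. In \<open>U\<close>, adding \<open>B_i\<close> or \<open>E_i\<close> produces
  neighbouring terms of one hybrid sequence. \<open>V\<close> holds all that the decoder reads
  besides \<open>B_i\<close>, and the past of \<open>A\<close>, which completes a chain
  rule.\<close>

definition Ui where "Ui i w = (take i (Bs w), drop (Suc i) (Es w), Zs w)"
definition Vi where "Vi i w = (Ys w, take i (Bs w), drop (Suc i) (Bs w), take i (As w))"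
definition Qj where "Qj j w = (Bs w, take j (Ys w), drop (Suc j) (Zs w))"
definition Tj where "Tj j w = (As w, Qj j w)"

text \<open>This is \<open>H(A_i|U_i,E_i)\<close>, split so that both terms are entropies of kernel
  outputs of \<open>A_i\<close> given \<open>U_i\<close>. In the same way \<open>hub\<close> is
  \<open>H(A_i|U_i,B_i)\<close> and \<open>hvb\<close> is \<open>H(A_i|V_i,B_i)\<close>.\<close>

definition hue where "hue i = cond_ent M (\<lambda>w. (As w ! i, Es w ! i)) (Ui i) - cond_ent M (\<lambda>w. Es w ! i) (Ui i)"
definition hub where "hub i = cond_ent M (\<lambda>w. (As w ! i, Bs w ! i)) (Ui i) - cond_ent M (\<lambda>w. Bs w ! i) (Ui i)"
definition hvb where "hvb i = cond_ent M (\<lambda>w. (As w ! i, Bs w ! i)) (Vi i) - cond_ent M (\<lambda>w. Bs w ! i) (Vi i)"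

section \<open>Invariance of the auxiliary variables and the telescoping sums\<close>

lemma invariant_Ui: "length s = n \<Longrightarrow> Ui i (s[i := (fst (s ! i), c)], r) = Ui i (s, r)"
  by (simp add: Ui_def Bs_def Es_def Zs_def map_update)

lemma map_fst_update: "map fst (s[i := (fst (s ! i), c)]) = map fst s"
  by (cases "i < length s") (simp_all add: map_update list_update_same_conv list_update_beyond)

lemma invariant_Vi: "length s = n \<Longrightarrow> Vi i (s[i := (fst (s ! i), c)], r) = Vi i (s, r)"
  by (simp add: Vi_def As_def Bs_def Ys_def map_update[of "fst \<circ> snd"] map_fst_update)

lemma invariant_Tj: "length yz = m \<Longrightarrow> Tj j (s, xs, yz[j := c]) = Tj j (s, xs, yz)"
  by (simp add: Tj_def Qj_def As_def Bs_def Ys_def Zs_def map_update)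

text \<open>Adding \<open>B_i\<close> to \<open>V_i\<close> completes \<open>B^n\<close>, so this is
  the plain chain rule for \<open>H(A^n|B^n,Y^m)\<close>.\<close>

lemma sum_hvb: "(\<Sum>i<n. hvb i) = ent M (\<lambda>w. (As w, Bs w, Ys w)) - ent M (\<lambda>w. (Bs w, Ys w))"
proof -
  define P where "P i = ent M (\<lambda>w. (take i (As w), Bs w, Ys w))" for i
  have "hvb i = P (Suc i) - P i" if "i < n" for i
  proof -
    have "ent M (\<lambda>w. ((As w ! i, Bs w ! i), Vi i w)) = P (Suc i)"
      unfolding P_def using that
      by (intro ent_cong) (auto simp: Vi_def take_Suc_eq_iff list_eq_iff_split[of i "Bs _"])
    moreover have "ent M (\<lambda>w. (Bs w ! i, Vi i w)) = P i"
      unfolding P_def using that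
      by (intro ent_cong) (auto simp: Vi_def list_eq_iff_split[of i "Bs _"])
    ultimately show ?thesis by (simp add: hvb_def cond_ent_def)
  qed
  then have "(\<Sum>i<n. hvb i) = P n - P 0" by (simp add: sum_lessThan_telescope)
  moreover have "P n = ent M (\<lambda>w. (As w, Bs w, Ys w))" "P 0 = ent M (\<lambda>w. (Bs w, Ys w))"
    unfolding P_def by (rule ent_cong; auto)+
  ultimately show ?thesis by simp
qed

text \<open>The hybrid \<open>P i\<close> has \<open>B\<close> before position \<open>i\<close> and
  \<open>E\<close> from there on. \<open>U_i\<close> with \<open>E_i\<close> is \<open>P i\<close>,
  with \<open>B_i\<close> it is \<open>P (Suc i)\<close>; the terms that also contain
  \<open>A_i\<close> contribute \<open>noise_gap\<close>.\<close>

lemma sum_hue_hub: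
  "(\<Sum>i<n. hue i - hub i) = real n * noise_gap + ent M (\<lambda>w. (Bs w, Zs w)) - ent M (\<lambda>w. (Es w, Zs w))"
proof -
  define P where "P i = ent M (\<lambda>w. (take i (Bs w), drop i (Es w), Zs w))" for i
  have "hue i - hub i = noise_gap + (P (Suc i) - P i)" if "i < n" for i
  proof -
    have "ent M (\<lambda>w. (Bs w ! i, Ui i w)) = P (Suc i)" "ent M (\<lambda>w. (Es w ! i, Ui i w)) = P i"
      unfolding P_def using that
      by (intro ent_cong; auto simp: Ui_def take_Suc_eq_iff drop_eq_iff[of i])+
    moreover have "ent M (\<lambda>w. ((As w ! i, Es w ! i), Ui i w)) = ent M (\<lambda>w. (Es w ! i, Ui i w, As w ! i))"
      "ent M (\<lambda>w. ((As w ! i, Bs w ! i), Ui i w)) = ent M (\<lambda>w. (Bs w ! i, Ui i w, As w ! i))"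
      by (rule ent_cong; auto)+
    ultimately show ?thesis
      using ent_exchange[OF that invariant_Ui[of _ i]] by (simp add: hue_def hub_def cond_ent_def)
  qed
  then have "(\<Sum>i<n. hue i - hub i) = (\<Sum>i<n. noise_gap + (P (Suc i) - P i))" by simp
  also have "\<dots> = real n * noise_gap + (P n - P 0)" by (simp add: sum.distrib sum_lessThan_telescope)
  moreover have "P n = ent M (\<lambda>w. (Bs w, Zs w))" "P 0 = ent M (\<lambda>w. (Es w, Zs w))"
    unfolding P_def by (rule ent_cong; auto)+
  ultimately show ?thesis by simp
qed

text \<open>The same hybrid on the channel side: \<open>Y\<close> before \<open>j\<close>,
  \<open>Z\<close> from \<open>j\<close> on, in the presence of \<open>B^n\<close>.\<close>

lemma sum_Qj:
  "(\<Sum>j<m. cond_ent M (\<lambda>w. Ys w ! j) (Qj j) - cond_ent M (\<lambda>w. Zs w ! j) (Qj j))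
    = ent M (\<lambda>w. (Bs w, Ys w)) - ent M (\<lambda>w. (Bs w, Zs w))"
proof -
  define P where "P j = ent M (\<lambda>w. (Bs w, take j (Ys w), drop j (Zs w)))" for j
  have "cond_ent M (\<lambda>w. Ys w ! j) (Qj j) - cond_ent M (\<lambda>w. Zs w ! j) (Qj j) = P (Suc j) - P j" if "j < m" for j
  proof -
    have "ent M (\<lambda>w. (Ys w ! j, Qj j w)) = P (Suc j)" "ent M (\<lambda>w. (Zs w ! j, Qj j w)) = P j"
      unfolding P_def using that
      by (intro ent_cong; auto simp: Qj_def take_Suc_eq_iff drop_eq_iff[of j])+
    then show ?thesis by (simp add: cond_ent_def)
  qed
  then have "(\<Sum>j<m. cond_ent M (\<lambda>w. Ys w ! j) (Qj j) - cond_ent M (\<lambda>w. Zs w ! j) (Qj j)) = P m - P 0"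
    by (simp add: sum_lessThan_telescope)
  moreover have "P m = ent M (\<lambda>w. (Bs w, Ys w))" "P 0 = ent M (\<lambda>w. (Bs w, Zs w))"
    unfolding P_def by (rule ent_cong; auto)+
  ultimately show ?thesis by simp
qed

lemma sum_Tj:
  "(\<Sum>j<m. cond_ent M (\<lambda>w. Ys w ! j) (Tj j) - cond_ent M (\<lambda>w. Zs w ! j) (Tj j))
    = ent M (\<lambda>w. (As w, Bs w, Ys w)) - ent M (\<lambda>w. (As w, Bs w, Zs w))"
proof -
  define P where "P j = ent M (\<lambda>w. (As w, Bs w, take j (Ys w), drop j (Zs w)))" for j
  have "cond_ent M (\<lambda>w. Ys w ! j) (Tj j) - cond_ent M (\<lambda>w. Zs w ! j) (Tj j) = P (Suc j) - P j" if "j < m" for j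
  proof -
    have "ent M (\<lambda>w. (Ys w ! j, Tj j w)) = P (Suc j)" "ent M (\<lambda>w. (Zs w ! j, Tj j w)) = P j"
      unfolding P_def using that
      by (intro ent_cong; auto simp: Tj_def Qj_def take_Suc_eq_iff drop_eq_iff[of j])+
    then show ?thesis by (simp add: cond_ent_def)
  qed
  then have "(\<Sum>j<m. cond_ent M (\<lambda>w. Ys w ! j) (Tj j) - cond_ent M (\<lambda>w. Zs w ! j) (Tj j)) = P m - P 0"
    by (simp add: sum_lessThan_telescope)
  moreover have "P m = ent M (\<lambda>w. (As w, Bs w, Ys w))" "P 0 = ent M (\<lambda>w. (As w, Bs w, Zs w))"
    unfolding P_def by (rule ent_cong; auto)+
  ultimately show ?thesis by simp
qed

text \<open>Trades \<open>E^n\<close> for \<open>B^n\<close> letter by letter while keeping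
  \<open>A^n\<close> and \<open>Z^m\<close>. It carries the equivocation at Eve over to the terms
  with \<open>B^n\<close> in which the channel sums are expressed.\<close>

lemma ent_AEZ: "ent M (\<lambda>w. (As w, Es w, Zs w)) = ent M (\<lambda>w. (As w, Bs w, Zs w)) + real n * noise_gap"
proof -
  define P where "P i = ent M (\<lambda>w. (As w, take i (Bs w), drop i (Es w), Zs w))" for i
  have "P i - P (Suc i) = noise_gap" if "i < n" for i
  proof -
    let ?F = "\<lambda>w. (As w, Ui i w)"
    have "ent M (\<lambda>w. (Es w ! i, ?F w, As w ! i)) - ent M (\<lambda>w. (Bs w ! i, ?F w, As w ! i)) = noise_gap"
      by (rule ent_exchange[OF that]) (simp add: invariant_Ui, simp add: As_def map_fst_update)
    moreover have "ent M (\<lambda>w. (Bs w ! i, ?F w, As w ! i)) = P (Suc i)"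
      "ent M (\<lambda>w. (Es w ! i, ?F w, As w ! i)) = P i"
      unfolding P_def using that
      by (intro ent_cong; auto simp: Ui_def take_Suc_eq_iff drop_eq_iff[of i])+
    ultimately show ?thesis by simp
  qed
  then have "(\<Sum>i<n. P i - P (Suc i)) = real n * noise_gap" by simp
  then have "P 0 - P n = real n * noise_gap" by (simp only: sum_lessThan_telescope')
  moreover have "P n = ent M (\<lambda>w. (As w, Bs w, Zs w))" "P 0 = ent M (\<lambda>w. (As w, Es w, Zs w))"
    unfolding P_def by (rule ent_cong; auto)+
  ultimately show ?thesis by simp
qed

text \<open>Source of the bound on \<Delta> by \<open>H(A|U,E)\<close> alone. Adding the past of
  \<open>A\<close> to the conditions lowers each \<open>hue i\<close> and makes the lower bounds
  telescope.\<close>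

lemma sum_hue_ge:
  "ent M (\<lambda>w. (As w, Es w, Zs w)) - ent M (\<lambda>w. (Es w, Zs w)) \<le> (\<Sum>i<n. hue i)"
proof -
  define P where "P i = ent M (\<lambda>w. (take i (As w), take i (Bs w), drop i (Es w), Zs w))" for i
  have "noise_gap + (P (Suc i) - P i) \<le> hue i" if "i < n" for i
  proof -
    let ?F = "\<lambda>w. (take i (As w), Ui i w)"
    have "cond_ent M (\<lambda>w. As w ! i) (\<lambda>w. (?F w, Es w ! i)) \<le> cond_ent M (\<lambda>w. As w ! i) (\<lambda>w. (Ui i w, Es w ! i))"
      by (rule cond_ent_mono[OF finite_M]) auto
    moreover have "ent M (\<lambda>w. (Es w ! i, ?F w, As w ! i)) - ent M (\<lambda>w. (Bs w ! i, ?F w, As w ! i)) = noise_gap"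
      by (rule ent_exchange[OF that]) (simp add: invariant_Ui, simp add: As_def map_fst_update)
    moreover have "ent M (\<lambda>w. (?F w, Es w ! i)) = P i"
      "ent M (\<lambda>w. (Bs w ! i, ?F w, As w ! i)) = P (Suc i)"
      unfolding P_def using that
      by (intro ent_cong; auto simp: Ui_def take_Suc_eq_iff drop_eq_iff[of i])+
    moreover have "ent M (\<lambda>w. (As w ! i, ?F w, Es w ! i)) = ent M (\<lambda>w. (Es w ! i, ?F w, As w ! i))"
      "ent M (\<lambda>w. (As w ! i, Ui i w, Es w ! i)) = ent M (\<lambda>w. ((As w ! i, Es w ! i), Ui i w))"
      "ent M (\<lambda>w. (Ui i w, Es w ! i)) = ent M (\<lambda>w. (Es w ! i, Ui i w))"
      by (rule ent_cong; auto)+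
    ultimately show ?thesis by (simp add: hue_def cond_ent_def)
  qed
  then have "(\<Sum>i<n. noise_gap + (P (Suc i) - P i)) \<le> (\<Sum>i<n. hue i)" by (intro sum_mono) auto
  then have "real n * noise_gap + (P n - P 0) \<le> (\<Sum>i<n. hue i)" by (simp add: sum.distrib sum_lessThan_telescope)
  moreover have "P n = ent M (\<lambda>w. (As w, Bs w, Zs w))" "P 0 = ent M (\<lambda>w. (Es w, Zs w))"
    unfolding P_def by (rule ent_cong; auto)+
  ultimately show ?thesis using ent_AEZ by simp
qed

text \<open>The left side is \<open>I(A^n;Y^m|B^n)\<close>. In its expansion over \<open>j\<close>,
  the first entropy grows when its conditions are dropped, and the second shrinks when they are
  enlarged to \<open>T_j\<close>.\<close>

lemma sum_information_ge:
  "ent M (\<lambda>w. (Bs w, Ys w)) - ent M Bs - ent M (\<lambda>w. (As w, Bs w, Ys w)) + ent M (\<lambda>w. (As w, Bs w))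
    \<le> (\<Sum>j<m. ent M (\<lambda>w. Ys w ! j) - cond_ent M (\<lambda>w. Ys w ! j) (Tj j))"
proof -
  define P where "P j = ent M (\<lambda>w. (Bs w, take j (Ys w)))" for j
  define R where "R j = ent M (\<lambda>w. (As w, Bs w, take j (Ys w)))" for j
  have "(P (Suc j) - P j) - (R (Suc j) - R j) \<le> ent M (\<lambda>w. Ys w ! j) - cond_ent M (\<lambda>w. Ys w ! j) (Tj j)" if "j < m" for j
  proof -
    have "cond_ent M (\<lambda>w. Ys w ! j) (\<lambda>w. (Bs w, take j (Ys w))) \<le> ent M (\<lambda>w. Ys w ! j)"
      by (rule cond_ent_le_ent[OF finite_M])
    moreover have "cond_ent M (\<lambda>w. Ys w ! j) (Tj j) \<le> cond_ent M (\<lambda>w. Ys w ! j) (\<lambda>w. (As w, Bs w, take j (Ys w)))"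
      by (rule cond_ent_mono[OF finite_M]) (auto simp: Tj_def Qj_def)
    moreover have "ent M (\<lambda>w. (Ys w ! j, Bs w, take j (Ys w))) = P (Suc j)"
      "ent M (\<lambda>w. (Ys w ! j, As w, Bs w, take j (Ys w))) = R (Suc j)"
      unfolding P_def R_def using that
      by (intro ent_cong; auto simp: take_Suc_eq_iff)+
    ultimately show ?thesis by (simp add: cond_ent_def P_def R_def)
  qed
  then have "(\<Sum>j<m. (P (Suc j) - P j) - (R (Suc j) - R j)) \<le>
      (\<Sum>j<m. ent M (\<lambda>w. Ys w ! j) - cond_ent M (\<lambda>w. Ys w ! j) (Tj j))" by (intro sum_mono) auto
  then have "(P m - P 0) - (R m - R 0) \<le> (\<Sum>j<m. ent M (\<lambda>w. Ys w ! j) - cond_ent M (\<lambda>w. Ys w ! j) (Tj j))"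
    by (simp only: sum_subtractf[of "\<lambda>j. P (Suc j) - P j"] sum_lessThan_telescope)
  moreover have "P m = ent M (\<lambda>w. (Bs w, Ys w))" "P 0 = ent M Bs"
    "R m = ent M (\<lambda>w. (As w, Bs w, Ys w))" "R 0 = ent M (\<lambda>w. (As w, Bs w))"
    unfolding P_def R_def by (rule ent_cong; auto)+
  ultimately show ?thesis by simp
qed

lemma ent_AB: "ent M (\<lambda>w. (As w, Bs w)) = real n * ent p (\<lambda>s. (fst s, fst (snd s)))"
proof -
  have "ent M (\<lambda>w. (As w, Bs w)) = ent M (\<lambda>w. map (\<lambda>s. (fst s, fst (snd s))) (fst w))"
    by (rule ent_cong) (auto simp: As_def Bs_def list_eq_iff_nth_eq dest!: set_M)
  also have "\<dots> = ent (map_pmf fst M) (map (\<lambda>s. (fst s, fst (snd s))))"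
    by (simp add: ent_map_pmf)
  finally show ?thesis by (simp add: map_fst_M ent_iid_pmf_map)
qed

lemma ent_B: "ent M Bs = real n * ent p (\<lambda>s. fst (snd s))"
proof -
  have "ent M Bs = ent (map_pmf fst M) (map (\<lambda>s. fst (snd s)))"
    by (simp add: ent_map_pmf Bs_def[abs_def] o_def)
  then show ?thesis by (simp add: map_fst_M ent_iid_pmf_map)
qed

end

section \<open>The compact regions\<close>

text \<open>\<open>H(A|B)\<close> as \<open>H(A,B) - H(B)\<close> when \<open>A\<close> has law
  \<open>v\<close>; the first kernel copies its input to the output.\<close>

definition ent_src_B :: "('a::finite \<Rightarrow> ('b::finite \<times> 'e::finite) pmf) \<Rightarrow> real ^ 'a \<Rightarrow> real" where
  "ent_src_B K v = output_ent (\<lambda>a. map_pmf (\<lambda>c. (a, fst c)) (K a)) v - output_ent (\<lambda>a. map_pmf fst (K a)) v"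

definition ent_src_E :: "('a::finite \<Rightarrow> ('b::finite \<times> 'e::finite) pmf) \<Rightarrow> real ^ 'a \<Rightarrow> real" where
  "ent_src_E K v = output_ent (\<lambda>a. map_pmf (\<lambda>c. (a, snd c)) (K a)) v - output_ent (\<lambda>a. map_pmf snd (K a)) v"

definition src_dist ::
  "('a::finite \<Rightarrow> ('b::finite \<times> 'e::finite) pmf) \<Rightarrow> ('a \<Rightarrow> 'a \<Rightarrow> real) \<Rightarrow> ('b \<Rightarrow> 'a) \<Rightarrow> real ^ 'a \<Rightarrow> real" where
  "src_dist K d f v = (\<Sum>a\<in>UNIV. \<Sum>c\<in>UNIV. v $ a * pmf (K a) c * d a (f (fst c)))"

definition ent_Y :: "('x::finite \<Rightarrow> ('y::finite \<times> 'z::finite) pmf) \<Rightarrow> real ^ 'x \<Rightarrow> real" where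
  "ent_Y W = output_ent (\<lambda>x. map_pmf fst (W x))"

definition ent_Z :: "('x::finite \<Rightarrow> ('y::finite \<times> 'z::finite) pmf) \<Rightarrow> real ^ 'x \<Rightarrow> real" where
  "ent_Z W = output_ent (\<lambda>x. map_pmf snd (W x))"

text \<open>One image of the simplex per reconstruction rule \<open>f\<close>. There are finitely
  many rules, which keeps the union compact, and a convex combination may use a different rule at
  each value of \<open>V\<close>.\<close>

definition gen_V where
  "gen_V K d = (\<Union>f\<in>UNIV. (\<lambda>v. (v, ent_src_B K v, src_dist K d f v)) ` prob_simplex)"

definition gen_U where
  "gen_U K = (\<lambda>v. (v, ent_src_E K v, ent_src_B K v)) ` prob_simplex"

definition gen_T where
  "gen_T W = (\<lambda>v. (v, ent_Y W v, ent_Z W v)) ` prob_simplex"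

text \<open>
  Two nested hulls for the Markov chain \<open>Q - T - X\<close>: the inner one splits each conditional law of \<open>X\<close>
  given \<open>Q\<close> along \<open>T\<close>, the outer one averages over \<open>Q\<close>. The last coordinate is \<open>H(Y|Q) - H(Z|Q)\<close>.
\<close>
definition gen_Q where
  "gen_Q W = (\<lambda>x. (fst x, fst (snd x), snd (snd x), ent_Y W (fst x) - ent_Z W (fst x))) ` (convex hull gen_T W)"

lemma convex_prob_simplex: "convex prob_simplex"
  unfolding convex_def prob_simplex_def
  by (auto simp: sum.distrib sum_distrib_left[symmetric])

lemma continuous_on_sources:
  "continuous_on prob_simplex (ent_src_B K)" "continuous_on prob_simplex (ent_src_E K)"
  "continuous_on prob_simplex (src_dist K d f)"
  "continuous_on prob_simplex (ent_Y W)" "continuous_on prob_simplex (ent_Z W)"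
  unfolding ent_src_B_def[abs_def] ent_src_E_def[abs_def] src_dist_def[abs_def] ent_Y_def ent_Z_def
  by (intro continuous_on_diff continuous_on_output_ent continuous_intros)+

lemma compact_hull_V: "compact (convex hull (gen_V K d))"
  unfolding gen_V_def
  by (intro compact_convex_hull compact_UN compact_continuous_image compact_prob_simplex
      continuous_on_Pair continuous_on_id continuous_on_sources) auto

lemma compact_hull_U: "compact (convex hull (gen_U K))"
  unfolding gen_U_def
  by (intro compact_convex_hull compact_continuous_image compact_prob_simplex
      continuous_on_Pair continuous_on_id continuous_on_sources)

lemma fst_hull_T: "x \<in> convex hull (gen_T W) \<Longrightarrow> fst x \<in> prob_simplex"
proof -
  have "convex hull (gen_T W) \<subseteq> prob_simplex \<times> UNIV"
    by (rule hull_minimal) (auto simp: gen_T_def intro!: convex_Times convex_prob_simplex)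
  then show "x \<in> convex hull (gen_T W) \<Longrightarrow> fst x \<in> prob_simplex" by auto
qed

lemma fst_hull_Q: "x \<in> convex hull (gen_Q W) \<Longrightarrow> fst x \<in> prob_simplex"
proof -
  have "convex hull (gen_Q W) \<subseteq> prob_simplex \<times> UNIV"
    by (rule hull_minimal) (auto simp: gen_Q_def intro!: convex_Times convex_prob_simplex dest: fst_hull_T)
  then show "x \<in> convex hull (gen_Q W) \<Longrightarrow> fst x \<in> prob_simplex" by auto
qed

lemma compact_hull_T: "compact (convex hull (gen_T W))"
  unfolding gen_T_def
  by (intro compact_convex_hull compact_continuous_image compact_prob_simplex
      continuous_on_Pair continuous_on_id continuous_on_sources)

lemma compact_hull_Q: "compact (convex hull (gen_Q W))"
proof -
  have "continuous_on (convex hull (gen_T W)) (\<lambda>x. ent_Y W (fst x) - ent_Z W (fst x))"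
    by (intro continuous_on_diff continuous_on_compose2[OF continuous_on_sources(4) continuous_on_fst]
        continuous_on_compose2[OF continuous_on_sources(5) continuous_on_fst] continuous_on_id)
      (auto dest: fst_hull_T)
  then show ?thesis
    unfolding gen_Q_def
    by (intro compact_convex_hull[of "_ ` _"] compact_continuous_image compact_hull_T
        continuous_on_Pair continuous_on_fst continuous_on_snd continuous_on_id)
qed

lemma sum_joint_row_fibre:
  assumes fin: "finite (set_pmf M)"
  shows "(\<Sum>t | t \<in> T ` set_pmf M \<and> \<phi> t = q. joint_row M T A t) = joint_row M (\<lambda>w. \<phi> (T w)) A q"
proof -
  have "(\<Sum>t | t \<in> T ` set_pmf M \<and> \<phi> t = q. pmf (map_pmf (\<lambda>w. (T w, A w)) M) (t, a))
      = pmf (map_pmf (\<lambda>w. (\<phi> (T w), A w)) M) (q, a)" for a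
  proof -
    have "(\<Sum>t | t \<in> T ` set_pmf M \<and> \<phi> t = q. pmf (map_pmf (\<lambda>w. (T w, A w)) M) (t, a))
      = (\<Sum>t | t \<in> T ` set_pmf M \<and> \<phi> t = q.
          \<Sum>w | w \<in> {w \<in> set_pmf M. \<phi> (T w) = q \<and> A w = a} \<and> T w = t. pmf M w)"
      unfolding pmf_map_sum[OF fin] by (intro sum.cong) auto
    also have "\<dots> = (\<Sum>w\<in>{w \<in> set_pmf M. \<phi> (T w) = q \<and> A w = a}. pmf M w)"
      using fin by (intro sum.group) auto
    finally show ?thesis by (simp add: pmf_map_sum[OF fin])
  qed
  then show ?thesis by (simp add: vec_eq_iff joint_row_def)
qed

text \<open>Group the rows of \<open>T\<close> by the value \<open>q\<close> of \<phi>. Inside a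
  cell, dividing by \<open>?P q\<close> gives a point of the inner hull whose first coordinate is
  the law of \<open>A\<close> given \<open>Q = q\<close>; the cells are then averaged with weights
  \<open>?P q\<close>.\<close>

lemma rows_in_hull_Q:
  fixes A :: "'w \<Rightarrow> 'x::finite" and W :: "'x \<Rightarrow> ('y::finite \<times> 'z::finite) pmf"
  assumes fin: "finite (set_pmf M)"
  shows "(law M A, \<Sum>t\<in>T ` set_pmf M. ent_Y W (joint_row M T A t), \<Sum>t\<in>T ` set_pmf M. ent_Z W (joint_row M T A t),
     \<Sum>q\<in>(\<lambda>w. \<phi> (T w)) ` set_pmf M. ent_Y W (joint_row M (\<lambda>w. \<phi> (T w)) A q) - ent_Z W (joint_row M (\<lambda>w. \<phi> (T w)) A q))
     \<in> convex hull (gen_Q W)"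
proof -
  let ?Q = "\<lambda>w. \<phi> (T w)"
  let ?Qs = "?Q ` set_pmf M"
  let ?I = "\<lambda>q. {t. t \<in> T ` set_pmf M \<and> \<phi> t = q}"
  let ?P = "\<lambda>q. pmf (map_pmf ?Q M) q"
  let ?G = "\<lambda>v. (ent_Y W v, ent_Z W v)"
  let ?y1 = "\<lambda>q. (1 / ?P q) *\<^sub>R (joint_row M ?Q A q, \<Sum>t\<in>?I q. ?G (joint_row M T A t))"
  let ?y = "\<lambda>q. (fst (?y1 q), fst (snd (?y1 q)), snd (snd (?y1 q)), ent_Y W (fst (?y1 q)) - ent_Z W (fst (?y1 q)))"
  have Ppos: "?P q > 0" if "q \<in> ?Qs" for q
    using that by (intro pmf_positive) auto
  have y1: "?y1 q \<in> convex hull (gen_T W)" if "q \<in> ?Qs" for q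
  proof -
    have "?P q = (\<Sum>a\<in>UNIV. joint_row M ?Q A q $ a)" by (simp add: sum_joint_row_component[OF fin])
    also have "\<dots> = (\<Sum>t\<in>?I q. \<Sum>a\<in>UNIV. joint_row M T A t $ a)"
      by (subst sum.swap) (simp add: sum_joint_row_fibre[OF fin, symmetric])
    finally have "(1 / ?P q) *\<^sub>R (\<Sum>t\<in>?I q. joint_row M T A t, \<Sum>t\<in>?I q. ?G (joint_row M T A t)) \<in> convex hull (gen_T W)"
      using fin Ppos[OF that] unfolding ent_Y_def ent_Z_def
      by (intro normalised_sum_in_convex_hull)
        (auto simp: joint_row_nonneg gen_T_def ent_Y_def ent_Z_def intro!: homogeneous_Pair homogeneous_output_ent)
    then show ?thesis by (simp only: sum_joint_row_fibre[OF fin])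
  qed
  have "(\<Sum>q\<in>?Qs. ?P q *\<^sub>R ?y q) \<in> convex hull (gen_Q W)"
  proof (rule convex_sum)
    show "sum ?P ?Qs = 1" using fin by (intro sum_pmf_eq_1) auto
    show "?y q \<in> convex hull (gen_Q W)" if "q \<in> ?Qs" for q
    proof (rule hull_inc)
      show "?y q \<in> gen_Q W"
        unfolding gen_Q_def using y1[OF that] by (rule image_eqI[rotated]) (rule refl)
    qed
  qed (use fin in auto)
  also have "(\<Sum>q\<in>?Qs. ?P q *\<^sub>R ?y q) = (\<Sum>q\<in>?Qs. (joint_row M ?Q A q, \<Sum>t\<in>?I q. ent_Y W (joint_row M T A t),
      \<Sum>t\<in>?I q. ent_Z W (joint_row M T A t), ent_Y W (joint_row M ?Q A q) - ent_Z W (joint_row M ?Q A q)))"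
  proof (intro sum.cong refl)
    fix q assume q: "q \<in> ?Qs"
    have Y: "?P q * ent_Y W ((1 / ?P q) *\<^sub>R joint_row M ?Q A q) = ent_Y W (joint_row M ?Q A q)"
      "?P q * ent_Z W ((1 / ?P q) *\<^sub>R joint_row M ?Q A q) = ent_Z W (joint_row M ?Q A q)"
      unfolding ent_Y_def ent_Z_def
      by (subst output_ent_scale; use Ppos[OF q] in \<open>simp add: joint_row_nonneg\<close>)+
    then show "?P q *\<^sub>R ?y q = (joint_row M ?Q A q, \<Sum>t\<in>?I q. ent_Y W (joint_row M T A t),
      \<Sum>t\<in>?I q. ent_Z W (joint_row M T A t), ent_Y W (joint_row M ?Q A q) - ent_Z W (joint_row M ?Q A q))"
      using Ppos[OF q] by (simp add: sum_prod right_diff_distrib del: pmf_map)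
  qed
  also have "\<dots> = (law M A, \<Sum>q\<in>?Qs. \<Sum>t\<in>?I q. ent_Y W (joint_row M T A t),
      \<Sum>q\<in>?Qs. \<Sum>t\<in>?I q. ent_Z W (joint_row M T A t), \<Sum>q\<in>?Qs. ent_Y W (joint_row M ?Q A q) - ent_Z W (joint_row M ?Q A q))"
    using sum_joint_row[OF fin, of ?Qs ?Q A] fin by (simp add: sum_prod)
  also have "\<dots> = (law M A, \<Sum>t\<in>T ` set_pmf M. ent_Y W (joint_row M T A t), \<Sum>t\<in>T ` set_pmf M. ent_Z W (joint_row M T A t),
     \<Sum>q\<in>?Qs. ent_Y W (joint_row M ?Q A q) - ent_Z W (joint_row M ?Q A q))"
    using fin by (subst (1 2) sum.group) auto
  finally show ?thesis .
qed

text \<open>A common first coordinate survives averaging. Every source position has the same law, so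
  this average takes the place of a time-sharing variable.\<close>

lemma convex_average:
  fixes x :: "nat \<Rightarrow> 'v::real_vector"
  assumes "convex C" "n > 0" "\<And>i. i < n \<Longrightarrow> (P, x i) \<in> C"
  shows "(P, (1 / real n) *\<^sub>R (\<Sum>i<n. x i)) \<in> C"
proof -
  have "(\<Sum>i<n. (1 / real n) *\<^sub>R (P, x i)) \<in> C"
    using assms by (intro convex_sum) auto
  also have "(\<Sum>i<n. (1 / real n) *\<^sub>R (P, x i)) = (P, (1 / real n) *\<^sub>R (\<Sum>i<n. x i))"
    using assms(2) by (simp add: sum_prod scaleR_sum_right sum_constant_scaleR)
  finally show ?thesis .
qed

context wiretap_code
begin

lemma law_As: "i < n \<Longrightarrow> law M (\<lambda>w. As w ! i) = law p fst"
  by (simp add: law_def nth_As)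

lemma markov_source_maps:
  assumes i: "i < n"
    and F: "\<And>s c r. length s = n \<Longrightarrow> F (s[i := (fst (s ! i), c)], r) = F (s, r)"
  shows "cond_ent M (\<lambda>w. (As w ! i, Bs w ! i)) F - cond_ent M (\<lambda>w. Bs w ! i) F
      = (\<Sum>f\<in>F ` set_pmf M. ent_src_B K (joint_row M F (\<lambda>w. As w ! i) f))"
    and "cond_ent M (\<lambda>w. (As w ! i, Es w ! i)) F - cond_ent M (\<lambda>w. Es w ! i) F
      = (\<Sum>f\<in>F ` set_pmf M. ent_src_E K (joint_row M F (\<lambda>w. As w ! i) f))"
proof -
  note mk = markov_source[OF i, of F, OF F]
  have "markov M F (\<lambda>w. As w ! i) (\<lambda>w. (As w ! i, Bs w ! i)) (\<lambda>a. map_pmf (\<lambda>c. (a, fst c)) (K a))"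
    "markov M F (\<lambda>w. As w ! i) (\<lambda>w. Bs w ! i) (\<lambda>a. map_pmf fst (K a))"
    "markov M F (\<lambda>w. As w ! i) (\<lambda>w. (As w ! i, Es w ! i)) (\<lambda>a. map_pmf (\<lambda>c. (a, snd c)) (K a))"
    "markov M F (\<lambda>w. As w ! i) (\<lambda>w. Es w ! i) (\<lambda>a. map_pmf snd (K a))"
    using markov_comp[OF mk, of "\<lambda>f _. f" "\<lambda>a c. (a, fst c)"] markov_comp[OF mk, of "\<lambda>f _. f" "\<lambda>_. fst"]
      markov_comp[OF mk, of "\<lambda>f _. f" "\<lambda>a c. (a, snd c)"] markov_comp[OF mk, of "\<lambda>f _. f" "\<lambda>_. snd"]
    by simp_all
  note this[THEN cond_ent_markov[OF finite_M]]
  then show "cond_ent M (\<lambda>w. (As w ! i, Bs w ! i)) F - cond_ent M (\<lambda>w. Bs w ! i) F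
      = (\<Sum>f\<in>F ` set_pmf M. ent_src_B K (joint_row M F (\<lambda>w. As w ! i) f))"
    "cond_ent M (\<lambda>w. (As w ! i, Es w ! i)) F - cond_ent M (\<lambda>w. Es w ! i) F
      = (\<Sum>f\<in>F ` set_pmf M. ent_src_E K (joint_row M F (\<lambda>w. As w ! i) f))"
    by (simp_all add: ent_src_B_def ent_src_E_def sum_subtractf)
qed

lemma hull_U:
  assumes "n > 0"
  shows "(law p fst, (1 / real n) * (\<Sum>i<n. hue i), (1 / real n) * (\<Sum>i<n. hub i)) \<in> convex hull (gen_U K)"
proof -
  have "(law p fst, hue i, hub i) \<in> convex hull (gen_U K)" if i: "i < n" for i
  proof -
    have "(law M (\<lambda>w. As w ! i), \<Sum>f\<in>Ui i ` set_pmf M. (ent_src_E K (joint_row M (Ui i) (\<lambda>w. As w ! i) f),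
        ent_src_B K (joint_row M (Ui i) (\<lambda>w. As w ! i) f))) \<in> convex hull (gen_U K)"
      unfolding ent_src_E_def[abs_def] ent_src_B_def[abs_def]
      by (rule rows_in_convex_hull[OF finite_M])
        (auto simp: gen_U_def ent_src_E_def ent_src_B_def
          intro!: homogeneous_Pair homogeneous_diff homogeneous_output_ent)
    then show ?thesis
      using markov_source_maps[OF i, of "Ui i", OF invariant_Ui]
      by (simp add: law_As[OF i] hue_def hub_def sum_prod)
  qed
  from convex_average[OF convex_convex_hull assms this]
  show ?thesis by (simp add: sum_prod)
qed

lemma hull_V:
  assumes "n > 0"
  shows "(law p fst, (1 / real n) * (\<Sum>i<n. hvb i),
      measure_pmf.expectation M (\<lambda>w. seq_dist d n (As w) (g (Ys w) (Bs w)))) \<in> convex hull (gen_V K d)"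
proof -
  have "(law p fst, hvb i, measure_pmf.expectation M (\<lambda>w. d (As w ! i) (g (Ys w) (Bs w) ! i)))
     \<in> convex hull (gen_V K d)" if i: "i < n" for i
  proof -
    let ?A = "\<lambda>w. As w ! i"
    \<comment> \<open>Putting \<open>b\<close> back at position \<open>i\<close> restores the whole
      word \<open>B^n\<close>, so the reconstruction of letter \<open>i\<close> is a function of
      \<open>V_i\<close> and \<open>B_i\<close>.\<close>
    let ?h = "\<lambda>v b. case v of (ys, b1, b2, a1) \<Rightarrow> g ys (b1 @ b # b2) ! i"
    have "(law M ?A, \<Sum>f\<in>Vi i ` set_pmf M. (ent_src_B K (joint_row M (Vi i) ?A f),
        src_dist K d (?h f) (joint_row M (Vi i) ?A f))) \<in> convex hull (gen_V K d)"
    proof (rule rows_in_convex_hull[OF finite_M])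
      fix f
      show "homogeneous (\<lambda>v. (ent_src_B K v, src_dist K d (?h f) v))"
        unfolding ent_src_B_def[abs_def]
        by (intro homogeneous_Pair homogeneous_diff homogeneous_output_ent)
          (simp add: homogeneous_def src_dist_def sum_distrib_left mult.assoc)
    qed (auto simp: gen_V_def)
    moreover have "measure_pmf.expectation M (\<lambda>w. d (As w ! i) (g (Ys w) (Bs w) ! i))
       = (\<Sum>f\<in>Vi i ` set_pmf M. src_dist K d (?h f) (joint_row M (Vi i) ?A f))"
    proof -
      have "measure_pmf.expectation M (\<lambda>w. d (As w ! i) (g (Ys w) (Bs w) ! i)) =
        measure_pmf.expectation M (\<lambda>w. d (As w ! i) (?h (Vi i w) (fst (Bs w ! i, Es w ! i))))"
        using i by (intro integral_cong_AE) (auto simp: AE_measure_pmf_iff Vi_def id_take_nth_drop[symmetric])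
      also have "\<dots> = (\<Sum>f\<in>Vi i ` set_pmf M. src_dist K d (?h f) (joint_row M (Vi i) ?A f))"
        unfolding src_dist_def
        by (rule expectation_markov[OF finite_M markov_source[OF i, of "Vi i", OF invariant_Vi],
          where \<psi> = "\<lambda>v a c. d a (?h v (fst c))"])
      finally show ?thesis .
    qed
    ultimately show ?thesis
      using markov_source_maps(1)[OF i, of "Vi i", OF invariant_Vi]
      by (simp add: law_As[OF i] hvb_def sum_prod)
  qed
  from convex_average[OF convex_convex_hull assms this]
  have "(law p fst, (1 / real n) * (\<Sum>i<n. hvb i),
      (1 / real n) * (\<Sum>i<n. measure_pmf.expectation M (\<lambda>w. d (As w ! i) (g (Ys w) (Bs w) ! i))))
      \<in> convex hull (gen_V K d)" by (simp add: sum_prod)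
  moreover have "measure_pmf.expectation M (\<lambda>w. seq_dist d n (As w) (g (Ys w) (Bs w)))
    = (1 / real n) * (\<Sum>i<n. measure_pmf.expectation M (\<lambda>w. d (As w ! i) (g (Ys w) (Bs w) ! i)))"
    unfolding seq_dist_def
    by (subst integral_mult_right_zero, subst Bochner_Integration.integral_sum)
      (auto intro: integrable_measure_pmf_finite finite_M)
  ultimately show ?thesis by simp
qed

lemma hull_Q:
  assumes j: "j < m"
  shows "(law M (\<lambda>w. Xs w ! j), cond_ent M (\<lambda>w. Ys w ! j) (Tj j), cond_ent M (\<lambda>w. Zs w ! j) (Tj j),
    cond_ent M (\<lambda>w. Ys w ! j) (Qj j) - cond_ent M (\<lambda>w. Zs w ! j) (Qj j)) \<in> convex hull (gen_Q W)"
proof -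
  note mT = markov_channel[OF j, of "Tj j", OF invariant_Tj]
  have Q: "Qj j = (\<lambda>w. snd (Tj j w))" by (simp add: fun_eq_iff Tj_def)
  have "markov M (Tj j) (\<lambda>w. Xs w ! j) (\<lambda>w. Ys w ! j) (\<lambda>x. map_pmf fst (W x))"
    "markov M (Tj j) (\<lambda>w. Xs w ! j) (\<lambda>w. Zs w ! j) (\<lambda>x. map_pmf snd (W x))"
    "markov M (Qj j) (\<lambda>w. Xs w ! j) (\<lambda>w. Ys w ! j) (\<lambda>x. map_pmf fst (W x))"
    "markov M (Qj j) (\<lambda>w. Xs w ! j) (\<lambda>w. Zs w ! j) (\<lambda>x. map_pmf snd (W x))"
    using markov_comp[OF mT, of "\<lambda>f _. f" "\<lambda>_. fst"] markov_comp[OF mT, of "\<lambda>f _. f" "\<lambda>_. snd"]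
      markov_comp[OF mT, of "\<lambda>f _. snd f" "\<lambda>_. fst"] markov_comp[OF mT, of "\<lambda>f _. snd f" "\<lambda>_. snd"]
    by (simp_all add: Q)
  note this[THEN cond_ent_markov[OF finite_M]]
  then show ?thesis
    using rows_in_hull_Q[OF finite_M, where A = "\<lambda>w. Xs w ! j" and T = "Tj j" and W = W and \<phi> = snd, folded Q]
    by (simp add: ent_Y_def ent_Z_def sum_subtractf)
qed

lemma ent_Ys_nth:
  assumes j: "j < m"
  shows "ent M (\<lambda>w. Ys w ! j) = ent_Y W (law M (\<lambda>w. Xs w ! j))"
proof -
  have "markov M (Tj j) (\<lambda>w. Xs w ! j) (\<lambda>w. (Ys w ! j, Zs w ! j)) W"
    by (rule markov_channel[OF j invariant_Tj])
  from markov_comp[OF this, of "\<lambda>f _. f" "\<lambda>_. fst"]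
  have "markov M (Tj j) (\<lambda>w. Xs w ! j) (\<lambda>w. Ys w ! j) (\<lambda>x. map_pmf fst (W x))" by simp
  then show ?thesis by (simp add: ent_markov[OF finite_M] ent_Y_def)
qed

end

section \<open>Letting the slack tend to zero\<close>

text \<open>The point of constant \<open>Q\<close> and \<open>T\<close>: it has
  \<open>I(T;Y) = 0\<close>, and its last three coordinates cancel in \<gamma> - \<alpha> +
  \<beta>.\<close>

lemma trivial_in_hull_Q:
  assumes "v \<in> prob_simplex"
  shows "(v, ent_Y W v, ent_Z W v, ent_Y W v - ent_Z W v) \<in> convex hull (gen_Q W)"
proof (rule hull_inc)
  have "(v, ent_Y W v, ent_Z W v) \<in> convex hull (gen_T W)"
    using assms by (intro hull_inc) (auto simp: gen_T_def)
  then show "(v, ent_Y W v, ent_Z W v, ent_Y W v - ent_Z W v) \<in> gen_Q W"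
    unfolding gen_Q_def by (rule image_eqI[rotated]) simp
qed

context wiretap_code
begin

text \<open>
  Averaging over the \<open>m\<close> channel uses with weights \<open>1/(n r)\<close>, and giving the remaining weight to a
  trivial point where \<open>T\<close> is constant, turns the bandwidth ratio \<open>m/n\<close> into exactly \<open>r\<close>, whatever the
  sign of \<open>I(T;Y|Q) - I(T;Z|Q)\<close>, and covers \<open>m = 0\<close>.
\<close>
lemma channel_point:
  assumes n: "n > 0" and r: "r > 0" "real m \<le> real n * r"
  obtains v \<alpha> \<beta> \<gamma> where "(v, \<alpha>, \<beta>, \<gamma>) \<in> convex hull (gen_Q W)"
    and "ent p (\<lambda>s. (fst s, fst (snd s))) - ent p (\<lambda>s. fst (snd s)) - (1 / real n) * (\<Sum>i<n. hvb i)
      \<le> r * (ent_Y W v - \<alpha>)"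
    and "(1 / real n) * (ent M (\<lambda>w. (As w, Es w, Zs w)) - ent M (\<lambda>w. (Es w, Zs w))) =
      (1 / real n) * (\<Sum>i<n. hue i) + (1 / real n) * (\<Sum>i<n. hvb i) - (1 / real n) * (\<Sum>i<n. hub i)
        + r * (\<gamma> - \<alpha> + \<beta>)"
proof -
  define v0 :: "real ^ 'x" where "v0 = axis undefined 1"
  have v0: "v0 \<in> prob_simplex" by (simp add: v0_def prob_simplex_def axis_def)
  \<comment> \<open>Index \<open>m\<close> carries the leftover weight, nonnegative because
    \<open>m <= n * r\<close>.\<close>
  define c where "c j = (if j < m then 1 / (real n * r) else 1 - real m / (real n * r))" for j
  define V where "V j = (if j < m then law M (\<lambda>w. Xs w ! j) else v0)" for j
  define a where "a j = (if j < m then cond_ent M (\<lambda>w. Ys w ! j) (Tj j) else ent_Y W v0)" for j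
  define b where "b j = (if j < m then cond_ent M (\<lambda>w. Zs w ! j) (Tj j) else ent_Z W v0)" for j
  define g where "g j = (if j < m then cond_ent M (\<lambda>w. Ys w ! j) (Qj j) - cond_ent M (\<lambda>w. Zs w ! j) (Qj j)
      else ent_Y W v0 - ent_Z W v0)" for j
  have nr: "real n * r > 0" using n r by simp
  have c0: "c j \<ge> 0" for j using nr r by (simp add: c_def divide_simps)
  have c1: "(\<Sum>j<Suc m. c j) = 1" using nr by (simp add: c_def)
  have pt: "(V j, a j, b j, g j) \<in> convex hull (gen_Q W)" for j
    using hull_Q[of j] trivial_in_hull_Q[OF v0, of W] by (simp add: V_def a_def b_def g_def)
  have V: "V j \<in> prob_simplex" for j using fst_hull_Q[OF pt[of j]] by simp
  have "(\<Sum>j<Suc m. c j *\<^sub>R (V j, a j, b j, g j)) \<in> convex hull (gen_Q W)"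
    by (rule convex_sum) (use c0 c1 pt in \<open>auto\<close>)
  then have mem: "(\<Sum>j<Suc m. c j *\<^sub>R V j, \<Sum>j<Suc m. c j * a j, \<Sum>j<Suc m. c j * b j, \<Sum>j<Suc m. c j * g j)
      \<in> convex hull (gen_Q W)" by (simp only: sum_prod scaleR_Pair real_scaleR_def)
  \<comment> \<open>A summand that vanishes at the trivial index sees only the weights
    \<open>1 / (n * r)\<close>, and the factor \<open>r\<close> turns these into
    \<open>1 / n\<close>.\<close>
  have scale: "r * (\<Sum>j<Suc m. c j * f j) = (1 / real n) * (\<Sum>j<m. f j)" if "f m = 0" for f :: "nat \<Rightarrow> real"
  proof -
    have "(\<Sum>j<Suc m. c j * f j) = (1 / (real n * r)) * (\<Sum>j<m. f j)"
      using that by (simp add: c_def sum_distrib_left)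
    then show ?thesis using r n by simp
  qed
  have "ent p (\<lambda>s. (fst s, fst (snd s))) - ent p (\<lambda>s. fst (snd s)) - (1 / real n) * (\<Sum>i<n. hvb i)
      = (1 / real n) * (ent M (\<lambda>w. (As w, Bs w)) - ent M Bs - (\<Sum>i<n. hvb i))"
    using n unfolding ent_AB ent_B by (simp add: field_simps)
  also have "\<dots> \<le> (1 / real n) * (\<Sum>j<m. ent M (\<lambda>w. Ys w ! j) - cond_ent M (\<lambda>w. Ys w ! j) (Tj j))"
    using sum_information_ge sum_hvb by (intro mult_left_mono) auto
  also have "\<dots> = (1 / real n) * (\<Sum>j<m. ent_Y W (V j) - a j)"
    by (simp add: V_def a_def ent_Ys_nth)
  also have "\<dots> = r * (\<Sum>j<Suc m. c j * (ent_Y W (V j) - a j))"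
    by (rule scale[symmetric]) (simp add: V_def a_def)
  also have "\<dots> = r * ((\<Sum>j<Suc m. c j * ent_Y W (V j)) - (\<Sum>j<Suc m. c j * a j))"
    by (simp only: right_diff_distrib sum_subtractf)
  \<comment> \<open>Concavity: the output entropy at the averaged input law dominates the average of
    the output entropies.\<close>
  also have "\<dots> \<le> r * (ent_Y W (\<Sum>j<Suc m. c j *\<^sub>R V j) - (\<Sum>j<Suc m. c j * a j))"
    using output_ent_concave[of "{..<Suc m}" c V] c0 c1 V r
    unfolding ent_Y_def by (intro mult_left_mono diff_right_mono) auto
  finally have rate: "ent p (\<lambda>s. (fst s, fst (snd s))) - ent p (\<lambda>s. fst (snd s)) - (1 / real n) * (\<Sum>i<n. hvb i)
      \<le> r * (ent_Y W (\<Sum>j<Suc m. c j *\<^sub>R V j) - (\<Sum>j<Suc m. c j * a j))" .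
  have "r * ((\<Sum>j<Suc m. c j * g j) - (\<Sum>j<Suc m. c j * a j) + (\<Sum>j<Suc m. c j * b j))
      = r * (\<Sum>j<Suc m. c j * (g j - a j + b j))"
    by (simp only: right_diff_distrib distrib_left sum_subtractf sum.distrib)
  also have "\<dots> = (1 / real n) * (\<Sum>j<m. g j - a j + b j)"
    by (rule scale) (simp add: g_def a_def b_def)
  also have "(\<Sum>j<m. g j - a j + b j) = (\<Sum>j<m. g j) - (\<Sum>j<m. a j - b j)"
    by (simp add: sum_subtractf[symmetric] algebra_simps)
  also have "(\<Sum>j<m. g j) = ent M (\<lambda>w. (Bs w, Ys w)) - ent M (\<lambda>w. (Bs w, Zs w))"
    using sum_Qj by (simp add: g_def)
  also have "(\<Sum>j<m. a j - b j) = ent M (\<lambda>w. (As w, Bs w, Ys w)) - ent M (\<lambda>w. (As w, Bs w, Zs w))"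
    using sum_Tj by (simp add: a_def b_def)
  finally have gap: "r * ((\<Sum>j<Suc m. c j * g j) - (\<Sum>j<Suc m. c j * a j) + (\<Sum>j<Suc m. c j * b j))
    = (1 / real n) * (ent M (\<lambda>w. (Bs w, Ys w)) - ent M (\<lambda>w. (Bs w, Zs w))
       - (ent M (\<lambda>w. (As w, Bs w, Ys w)) - ent M (\<lambda>w. (As w, Bs w, Zs w))))" .
  \<comment> \<open>An equality: \<open>ent_AEZ\<close> brings \<open>n * noise_gap\<close> to the
    left and \<open>sum_hue_hub\<close> brings it to the right, where all entropies of
    \<open>(B,Y)\<close>, \<open>(B,Z)\<close> and \<open>(A,B,Y)\<close> cancel.\<close>
  have "(1 / real n) * (ent M (\<lambda>w. (As w, Es w, Zs w)) - ent M (\<lambda>w. (Es w, Zs w))) =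
      (1 / real n) * ((\<Sum>i<n. hue i - hub i) + (\<Sum>i<n. hvb i)
      + (ent M (\<lambda>w. (Bs w, Ys w)) - ent M (\<lambda>w. (Bs w, Zs w))
       - (ent M (\<lambda>w. (As w, Bs w, Ys w)) - ent M (\<lambda>w. (As w, Bs w, Zs w)))))"
    unfolding sum_hue_hub sum_hvb ent_AEZ by simp
  also have "\<dots> = (1 / real n) * (\<Sum>i<n. hue i) + (1 / real n) * (\<Sum>i<n. hvb i) - (1 / real n) * (\<Sum>i<n. hub i)
        + r * ((\<Sum>j<Suc m. c j * g j) - (\<Sum>j<Suc m. c j * a j) + (\<Sum>j<Suc m. c j * b j))"
    unfolding gap sum_subtractf by (simp only: ring_distribs)
  finally show ?thesis by (rule that[OF mem rate])
qed

end

text \<open>The lengths \<open>n\<close> and \<open>m\<close> have disappeared: the three hulls are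
  the same for all codes, and \<epsilon> occurs only in the shifts of \<open>k\<close>,
  \<open>D\<close> and \<Delta>.\<close>

lemma achievable_imp_points:
  fixes p :: "('a::finite \<times> 'b::finite \<times> 'e::finite) pmf"
    and W :: "'x::finite \<Rightarrow> ('y::finite \<times> 'z::finite) pmf"
  assumes ach: "achievable p W d k D \<Delta>"
    and K: "p = bind_pmf p (\<lambda>s. map_pmf (Pair (fst s)) (K (fst s)))" and \<epsilon>: "\<epsilon> > 0"
  shows "\<exists>hv \<delta> he hb v \<alpha> \<beta> \<gamma>. (law p fst, hv, \<delta>) \<in> convex hull (gen_V K d) \<and>
    (law p fst, he, hb) \<in> convex hull (gen_U K) \<and> (v, \<alpha>, \<beta>, \<gamma>) \<in> convex hull (gen_Q W) \<and>
    ent p (\<lambda>s. (fst s, fst (snd s))) - ent p (\<lambda>s. fst (snd s)) - hv \<le> (k + \<epsilon>) * (ent_Y W v - \<alpha>) \<and>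
    \<delta> \<le> D + \<epsilon> \<and> \<Delta> - \<epsilon> \<le> he \<and> \<Delta> - \<epsilon> \<le> he + hv - hb + (k + \<epsilon>) * (\<gamma> - \<alpha> + \<beta>)"
proof -
  from ach \<epsilon> obtain n m and enc :: "'a list \<Rightarrow> 'x list pmf" and g :: "'y list \<Rightarrow> 'b list \<Rightarrow> 'a list"
    where n: "0 < n" and enc: "\<And>as xs. length as = n \<Longrightarrow> xs \<in> set_pmf (enc as) \<Longrightarrow> length xs = m"
      and rate: "real m / real n \<le> k + \<epsilon>"
      and dist: "measure_pmf.expectation (code_joint p W n enc)
           (\<lambda>(s, xs, yz). seq_dist d n (map fst s) (g (map fst yz) (map (fst \<circ> snd) s))) \<le> D + \<epsilon>"
      and equiv: "cond_ent (code_joint p W n enc) (\<lambda>(s, xs, yz). map fst s)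
           (\<lambda>(s, xs, yz). (map (snd \<circ> snd) s, map snd yz)) / real n \<ge> \<Delta> - \<epsilon>"
    unfolding achievable_def by meson
  have k: "0 \<le> k" using ach by (simp add: achievable_def)
  interpret wiretap_code p W n m enc K
    using K enc by unfold_locales auto
  have r: "k + \<epsilon> > 0" using k \<epsilon> by simp
  have "real m \<le> real n * (k + \<epsilon>)" using rate n by (simp add: field_simps)
  from channel_point[OF n r this] obtain v \<alpha> \<beta> \<gamma> where pt: "(v, \<alpha>, \<beta>, \<gamma>) \<in> convex hull (gen_Q W)"
    "ent p (\<lambda>s. (fst s, fst (snd s))) - ent p (\<lambda>s. fst (snd s)) - (1 / real n) * (\<Sum>i<n. hvb i)
      \<le> (k + \<epsilon>) * (ent_Y W v - \<alpha>)"
    "(1 / real n) * (ent M (\<lambda>w. (As w, Es w, Zs w)) - ent M (\<lambda>w. (Es w, Zs w))) =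
      (1 / real n) * (\<Sum>i<n. hue i) + (1 / real n) * (\<Sum>i<n. hvb i) - (1 / real n) * (\<Sum>i<n. hub i)
        + (k + \<epsilon>) * (\<gamma> - \<alpha> + \<beta>)" by blast
  have dist': "measure_pmf.expectation M (\<lambda>w. seq_dist d n (As w) (g (Ys w) (Bs w))) \<le> D + \<epsilon>"
    using dist by (simp add: As_def Ys_def Bs_def case_prod_unfold)
  have equiv': "\<Delta> - \<epsilon> \<le> (1 / real n) * (ent M (\<lambda>w. (As w, Es w, Zs w)) - ent M (\<lambda>w. (Es w, Zs w)))"
    using equiv by (simp add: As_def Es_def Zs_def case_prod_unfold cond_ent_def)
  also have "\<dots> \<le> (1 / real n) * (\<Sum>i<n. hue i)"
    using sum_hue_ge by (intro mult_left_mono) auto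
  finally have "\<Delta> - \<epsilon> \<le> (1 / real n) * (\<Sum>i<n. hue i)" .
  then show ?thesis
    using hull_V[OF n, of d g] hull_U[OF n] pt dist' equiv' by (metis (no_types, lifting))
qed

lemma achievable_imp_point:
  fixes p :: "('a::finite \<times> 'b::finite \<times> 'e::finite) pmf"
    and W :: "'x::finite \<Rightarrow> ('y::finite \<times> 'z::finite) pmf"
  assumes ach: "achievable p W d k D \<Delta>"
    and K: "p = bind_pmf p (\<lambda>s. map_pmf (Pair (fst s)) (K (fst s)))"
  shows "\<exists>hv \<delta> he hb v \<alpha> \<beta> \<gamma>. (law p fst, hv, \<delta>) \<in> convex hull (gen_V K d) \<and>
    (law p fst, he, hb) \<in> convex hull (gen_U K) \<and> (v, \<alpha>, \<beta>, \<gamma>) \<in> convex hull (gen_Q W) \<and>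
    ent p (\<lambda>s. (fst s, fst (snd s))) - ent p (\<lambda>s. fst (snd s)) - hv \<le> k * (ent_Y W v - \<alpha>) \<and>
    \<delta> \<le> D \<and> \<Delta> \<le> he \<and> \<Delta> \<le> he + hv - hb + k * (\<gamma> - \<alpha> + \<beta>)"
proof -
  let ?H = "ent p (\<lambda>s. (fst s, fst (snd s))) - ent p (\<lambda>s. fst (snd s))"
  \<comment> \<open>The slack is carried along as a further coordinate, confined to
    \<open>{0..1}\<close> to keep the set compact.\<close>
  define C where "C = (convex hull (gen_V K d)) \<times> (convex hull (gen_U K)) \<times> (convex hull (gen_Q W)) \<times> {0..1::real}"
  have C: "compact C" unfolding C_def
    by (intro compact_Times compact_hull_V compact_hull_U compact_hull_Q compact_Icc)
  let ?v = "\<lambda>x. fst x" and ?u = "\<lambda>x. fst (snd x)" and ?q = "\<lambda>x. fst (snd (snd x))" and ?e = "\<lambda>x. snd (snd (snd x))"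
  let ?hv = "\<lambda>x. fst (snd (?v x))" and ?\<delta> = "\<lambda>x. snd (snd (?v x))"
  let ?he = "\<lambda>x. fst (snd (?u x))" and ?hb = "\<lambda>x. snd (snd (?u x))"
  let ?\<alpha> = "\<lambda>x. fst (snd (?q x))" and ?\<beta> = "\<lambda>x. fst (snd (snd (?q x)))" and ?\<gamma> = "\<lambda>x. snd (snd (snd (?q x)))"
  have cY: "continuous_on C (\<lambda>x. ent_Y W (fst (?q x)))"
    by (rule continuous_on_compose2[OF continuous_on_sources(4)])
      (auto simp: C_def intro!: continuous_intros dest: fst_hull_Q)
  define S where "S = {x \<in> C. fst (?v x) = law p fst} \<inter> {x \<in> C. fst (?u x) = law p fst} \<inter>
     {x \<in> C. ?H - ?hv x \<le> (k + ?e x) * (ent_Y W (fst (?q x)) - ?\<alpha> x)} \<inter>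
     {x \<in> C. ?\<delta> x \<le> D + ?e x} \<inter> {x \<in> C. \<Delta> - ?e x \<le> ?he x} \<inter>
     {x \<in> C. \<Delta> - ?e x \<le> ?he x + ?hv x - ?hb x + (k + ?e x) * (?\<gamma> x - ?\<alpha> x + ?\<beta> x)}"
  have "closed S"
    unfolding S_def
    by (intro closed_Int continuous_on_closed_Collect_le continuous_closed_preimage_constant
      continuous_intros cY compact_imp_closed[OF C])
  then have "compact S"
    using compact_Int_closed[OF C, of S] by (simp add: S_def Int_absorb1 inf.absorb2 le_infI1 Collect_restrict)
  then have "compact (?e ` S)"
    by (intro compact_continuous_image continuous_intros)
  then have cl: "closed (?e ` S)" by (rule compact_imp_closed)
  \<comment> \<open>The projection of \<open>S\<close> to the slack contains \<open>(0, 1]\<close>;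
    being closed, it also contains 0.\<close>
  have "e \<in> ?e ` S" if e: "0 < e" "e \<le> 1" for e
  proof -
    from achievable_imp_points[OF ach K e(1)] obtain hv \<delta> he hb v \<alpha> \<beta> \<gamma> where
      "(law p fst, hv, \<delta>) \<in> convex hull (gen_V K d)"
      "(law p fst, he, hb) \<in> convex hull (gen_U K)" "(v, \<alpha>, \<beta>, \<gamma>) \<in> convex hull (gen_Q W)"
      "?H - hv \<le> (k + e) * (ent_Y W v - \<alpha>)"
      "\<delta> \<le> D + e" "\<Delta> - e \<le> he" "\<Delta> - e \<le> he + hv - hb + (k + e) * (\<gamma> - \<alpha> + \<beta>)"
      by blast
    then have "((law p fst, hv, \<delta>), (law p fst, he, hb), (v, \<alpha>, \<beta>, \<gamma>), e) \<in> S"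
      using e by (simp add: S_def C_def)
    then show ?thesis by (rule image_eqI[rotated]) simp
  qed
  then have sub: "inverse (real (Suc l)) \<in> ?e ` S" for l
    by (simp add: inverse_le_1_iff)
  have "(0::real) \<in> ?e ` S"
    using closed_sequentially[OF cl sub LIMSEQ_inverse_real_of_nat] .
  then obtain x where x: "x \<in> S" "?e x = 0" by auto
  obtain v1 hv \<delta> v2 he hb v \<alpha> \<beta> \<gamma> e where xe: "x = ((v1, hv, \<delta>), (v2, he, hb), (v, \<alpha>, \<beta>, \<gamma>), e)"
    by (metis prod.exhaust)
  show ?thesis
    using x unfolding xe S_def C_def by simp blast
qed

section \<open>Realising points of the convex hulls\<close>

lemma pmf_of_weights:
  fixes u :: "'v \<Rightarrow> real"
  assumes fin: "finite S" and nn: "\<And>x. x \<in> S \<Longrightarrow> 0 \<le> u x" and one: "sum u S = 1"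
  obtains N where "\<And>x. pmf N x = (if x \<in> S then u x else 0)"
proof
  let ?f = "\<lambda>x. if x \<in> S then u x else 0"
  have "(\<integral>\<^sup>+x. ennreal (?f x) \<partial>count_space UNIV) = (\<Sum>x\<in>S. ennreal (?f x))"
    using fin by (intro nn_integral_count_space') auto
  also have "\<dots> = 1"
    using nn one by (simp add: sum_ennreal)
  finally show "pmf (embed_pmf ?f) x = ?f x" for x
    using nn by (intro pmf_embed_pmf) auto
qed

lemma convex_hull_pmf:
  fixes y :: "'v::real_vector"
  assumes "y \<in> convex hull S"
  obtains N :: "nat pmf" and x where "finite (set_pmf N)" "\<And>i. x i \<in> S"
    "y = (\<Sum>i\<in>set_pmf N. pmf N i *\<^sub>R x i)"
proof -
  from assms obtain T u where T: "finite T" "T \<subseteq> S" "\<forall>x\<in>T. 0 \<le> u x" "sum u T = 1"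
    and y: "(\<Sum>v\<in>T. u v *\<^sub>R v) = y"
    unfolding convex_hull_explicit by auto
  obtain N where N: "\<And>x. pmf N x = (if x \<in> T then u x else 0)"
    using pmf_of_weights[of T u] T by auto
  have NT: "set_pmf N \<subseteq> T" using N by (auto simp: set_pmf_iff split: if_splits)
  obtain h :: "'v \<Rightarrow> nat" where h: "inj_on h T" using finite_imp_inj_to_nat_seg[OF T(1)] by auto
  have hN: "inj_on h (set_pmf N)" using h NT by (rule inj_on_subset)
  obtain t where t: "t \<in> T" using T(4) by fastforce
  let ?x = "\<lambda>i. if i \<in> h ` T then inv_into T h i else t"
  have "y = (\<Sum>v\<in>set_pmf N. pmf N v *\<^sub>R v)"
    unfolding y[symmetric] using T(1) NT
    by (intro sum.mono_neutral_cong_right) (auto simp: N set_pmf_iff)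
  also have "\<dots> = (\<Sum>i\<in>set_pmf (map_pmf h N). pmf (map_pmf h N) i *\<^sub>R ?x i)"
    unfolding set_map_pmf using NT
    by (subst sum.reindex[OF hN]) (auto intro!: sum.cong simp: pmf_map_inj[OF hN] inv_into_f_f[OF h])
  finally have "y = (\<Sum>i\<in>set_pmf (map_pmf h N). pmf (map_pmf h N) i *\<^sub>R ?x i)" .
  moreover have "?x i \<in> S" for i using T(2) t inv_into_into[of i h T] by auto
  moreover have "finite (set_pmf (map_pmf h N))" using finite_subset[OF NT T(1)] by simp
  ultimately show thesis by (intro that[of "map_pmf h N" ?x])
qed

lemma pmf_bind_Pair: "pmf (bind_pmf N (\<lambda>i. map_pmf (Pair i) (L i))) (i, y) = pmf N i * pmf (L i) y"
proof -
  have "pmf (map_pmf (Pair j) (L j)) (i, y) = indicat_real {i} j * pmf (L i) y" for j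
  proof (cases "j = i")
    case True
    then show ?thesis using pmf_map_inj'[of "Pair i" "L i" y] by (simp add: inj_on_def)
  next
    case False
    then show ?thesis by (auto simp: pmf_eq_0_set_pmf)
  qed
  then show ?thesis by (simp add: pmf_bind measure_pmf_single)
qed

text \<open>The index of the combination becomes the auxiliary variable, its weight the probability
  of that value, and the simplex vector at the index the conditional law of the letter.\<close>

lemma convex_hull_joint_pmf:
  fixes S :: "((real ^ 'a::finite) \<times> 'v::real_vector) set"
  assumes y: "y \<in> convex hull S" and S: "\<And>s. s \<in> S \<Longrightarrow> fst s \<in> prob_simplex"
  obtains N :: "(nat \<times> 'a) pmf" and x where "finite (set_pmf N)" "\<And>i. x i \<in> S"
    "\<And>i. joint_row N fst snd i = pmf (map_pmf fst N) i *\<^sub>R fst (x i)"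
    "y = (\<Sum>i\<in>fst ` set_pmf N. pmf (map_pmf fst N) i *\<^sub>R x i)"
    "law N snd = fst y"
proof -
  obtain N0 :: "nat pmf" and x where N0: "finite (set_pmf N0)" "\<And>i. x i \<in> S"
    "y = (\<Sum>i\<in>set_pmf N0. pmf N0 i *\<^sub>R x i)"
    using convex_hull_pmf[OF y] by blast
  have "\<exists>L. \<forall>a. pmf L a = fst (x i) $ a" for i
  proof -
    have "fst (x i) \<in> prob_simplex" using S N0(2) by auto
    then have "\<And>a. 0 \<le> fst (x i) $ a" "(\<Sum>a\<in>UNIV. fst (x i) $ a) = 1"
      by (auto simp: prob_simplex_def)
    from pmf_of_weights[of UNIV "\<lambda>a. fst (x i) $ a", OF finite this]
    obtain L where "\<And>a. pmf L a = (if a \<in> UNIV then fst (x i) $ a else 0)" by blast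
    then have "\<forall>a. pmf L a = fst (x i) $ a" by simp
    then show ?thesis ..
  qed
  then obtain L where L: "\<And>i a. pmf (L i) a = fst (x i) $ a" by metis
  define N where "N = bind_pmf N0 (\<lambda>i. map_pmf (Pair i) (L i))"
  have fst_N: "map_pmf fst N = N0"
    by (simp add: N_def map_bind_pmf pmf.map_comp o_def map_pmf_const bind_return_pmf')
  have fin: "finite (set_pmf N)" using N0(1) by (simp add: N_def)
  have supp: "fst ` set_pmf N = set_pmf N0" using fst_N set_map_pmf[of fst N] by simp
  have rows: "joint_row N fst snd i = pmf N0 i *\<^sub>R fst (x i)" for i
    by (simp add: joint_row_def vec_eq_iff) (simp add: N_def pmf_bind_Pair L)
  have "law N snd = (\<Sum>i\<in>fst ` set_pmf N. joint_row N fst snd i)"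
    using fin by (simp add: sum_joint_row)
  also have "\<dots> = fst y"
    by (simp add: rows supp N0(3) fst_sum)
  finally have "law N snd = fst y" .
  then show thesis
    using that[of N x] fin N0 rows by (simp add: fst_N supp)
qed

lemma law_eq_imp_map_pmf_eq: "law M A = law N B \<Longrightarrow> map_pmf A M = map_pmf B N"
  by (intro pmf_eqI) (simp add: law_def vec_eq_iff)

lemma gen_fst_simplex:
  "s \<in> gen_V K d \<Longrightarrow> fst s \<in> prob_simplex" "s \<in> gen_U K \<Longrightarrow> fst s \<in> prob_simplex"
  "s \<in> gen_T W \<Longrightarrow> fst s \<in> prob_simplex"
  by (auto simp: gen_V_def gen_U_def gen_T_def)

text \<open>Undoes the two hulls in turn: the outer combination supplies \<open>Q\<close>, and each
  of its points expands in the inner hull to a law \<open>L i\<close> of \<open>(T, X)\<close> given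
  \<open>Q = i\<close>.\<close>

lemma hull_Q_joint_pmf:
  fixes W :: "'x::finite \<Rightarrow> ('y::finite \<times> 'z::finite) pmf"
  assumes y: "(v, \<alpha>, \<beta>, \<gamma>) \<in> convex hull (gen_Q W)"
  obtains N :: "(nat \<times> 'x) pmf" and \<phi> :: "nat \<Rightarrow> nat" where "finite (set_pmf N)" "law N snd = v"
    "(\<Sum>t\<in>fst ` set_pmf N. ent_Y W (joint_row N fst snd t)) = \<alpha>"
    "(\<Sum>t\<in>fst ` set_pmf N. ent_Z W (joint_row N fst snd t)) = \<beta>"
    "(\<Sum>q\<in>(\<lambda>w. \<phi> (fst w)) ` set_pmf N. ent_Y W (joint_row N (\<lambda>w. \<phi> (fst w)) snd q)
        - ent_Z W (joint_row N (\<lambda>w. \<phi> (fst w)) snd q)) = \<gamma>"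
proof -
  obtain N0 :: "nat pmf" and x where N0: "finite (set_pmf N0)" "\<And>i. x i \<in> gen_Q W"
    "(v, \<alpha>, \<beta>, \<gamma>) = (\<Sum>i\<in>set_pmf N0. pmf N0 i *\<^sub>R x i)"
    using convex_hull_pmf[OF y] by blast
  have "\<exists>z. z \<in> convex hull (gen_T W) \<and> x i = (fst z, fst (snd z), snd (snd z), ent_Y W (fst z) - ent_Z W (fst z))" for i
    using N0(2)[of i] by (auto simp: gen_Q_def)
  then obtain z where z: "\<And>i. z i \<in> convex hull (gen_T W)"
    "\<And>i. x i = (fst (z i), fst (snd (z i)), snd (snd (z i)), ent_Y W (fst (z i)) - ent_Z W (fst (z i)))" by metis
  define R where "R i L s \<longleftrightarrow> finite (set_pmf L) \<and> (\<forall>t. s t \<in> gen_T W) \<and>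
      (\<forall>t. joint_row L fst snd t = pmf (map_pmf fst L) t *\<^sub>R fst (s t)) \<and>
      z i = (\<Sum>t\<in>fst ` set_pmf L. pmf (map_pmf fst L) t *\<^sub>R s t) \<and> law L snd = fst (z i)"
    for i and L :: "(nat \<times> 'x) pmf" and s
  have "\<exists>L s. R i L s" for i
    unfolding R_def
    by (rule convex_hull_joint_pmf[OF z(1)[of i] gen_fst_simplex(3)], assumption)
      (intro exI conjI allI, assumption+)
  then obtain L s where "\<And>i. R i (L i) (s i)" by metis
  then have L: "\<And>i. finite (set_pmf (L i))"
    "\<And>i t. s i t \<in> gen_T W" "\<And>i t. joint_row (L i) fst snd t = pmf (map_pmf fst (L i)) t *\<^sub>R fst (s i t)"
    "\<And>i. z i = (\<Sum>t\<in>fst ` set_pmf (L i). pmf (map_pmf fst (L i)) t *\<^sub>R s i t)"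
    "\<And>i. law (L i) snd = fst (z i)" by (simp_all only: R_def)
  have s: "s i t = (fst (s i t), ent_Y W (fst (s i t)), ent_Z W (fst (s i t)))" "fst (s i t) \<in> prob_simplex" for i t
    using L(2)[of i t] by (auto simp: gen_T_def)
  have zY: "fst (snd (z i)) = (\<Sum>t\<in>fst ` set_pmf (L i). ent_Y W (joint_row (L i) fst snd t))"
    and zZ: "snd (snd (z i)) = (\<Sum>t\<in>fst ` set_pmf (L i). ent_Z W (joint_row (L i) fst snd t))" for i
  proof -
    have sY: "fst (snd (s i t)) = ent_Y W (fst (s i t))" "snd (snd (s i t)) = ent_Z W (fst (s i t))" for t
      using s(1)[of i t] by (metis fst_conv snd_conv)+
    have "ent_Y W (joint_row (L i) fst snd t) = pmf (map_pmf fst (L i)) t * ent_Y W (fst (s i t))"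
      "ent_Z W (joint_row (L i) fst snd t) = pmf (map_pmf fst (L i)) t * ent_Z W (fst (s i t))" for t
      unfolding L(3) ent_Y_def ent_Z_def using s(2)[of i t]
      by (auto simp: prob_simplex_def intro!: output_ent_scale)
    then show "fst (snd (z i)) = (\<Sum>t\<in>fst ` set_pmf (L i). ent_Y W (joint_row (L i) fst snd t))"
      "snd (snd (z i)) = (\<Sum>t\<in>fst ` set_pmf (L i). ent_Z W (joint_row (L i) fst snd t))"
      by (simp_all only: L(4)[of i] fst_sum snd_sum fst_scaleR snd_scaleR sY real_scaleR_def)
  qed
  define N1 where "N1 = bind_pmf N0 (\<lambda>i. map_pmf (Pair i) (L i))"
  \<comment> \<open>\<open>T\<close> carries the value of \<open>Q\<close>, which \<open>\<phi>\<close> recovers\<close>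
  define e where "e = (\<lambda>(i, t, x :: 'x). (prod_encode (i, t), x))"
  define N where "N = map_pmf e N1"
  define \<phi> where "\<phi> t = fst (prod_decode t)" for t
  have inj: "inj e" by (auto simp: e_def inj_on_def)
  have fin1: "finite (set_pmf N1)" using N0(1) L(1) by (auto simp: N1_def)
  have fin: "finite (set_pmf N)" using fin1 by (simp add: N_def)
  have setN: "set_pmf N = e ` (SIGMA i : set_pmf N0. set_pmf (L i))"
    by (auto simp: N_def N1_def)
  have row: "joint_row N fst snd (prod_encode (i, t)) = pmf N0 i *\<^sub>R joint_row (L i) fst snd t" for i t
  proof -
    have "pmf N (prod_encode (i, t), x) = pmf N0 i * pmf (L i) (t, x)" for x
      using pmf_map_inj'[OF inj, of N1 "(i, t, x)"] by (simp add: N_def e_def N1_def pmf_bind_Pair)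
    then show ?thesis by (simp add: joint_row_def vec_eq_iff)
  qed
  have fstN: "fst ` set_pmf N = prod_encode ` (SIGMA i : set_pmf N0. fst ` set_pmf (L i))"
    unfolding setN by (force simp: e_def image_iff)
  have reindex: "(\<Sum>t\<in>fst ` set_pmf N. f (joint_row N fst snd t)) =
      (\<Sum>i\<in>set_pmf N0. \<Sum>t\<in>fst ` set_pmf (L i). f (pmf N0 i *\<^sub>R joint_row (L i) fst snd t))"
    for f :: "real ^ 'x \<Rightarrow> 'c::comm_monoid_add"
    unfolding fstN using N0(1) L(1)
    by (subst sum.reindex) (auto simp: inj_on_def row sum.Sigma intro!: sum.cong)
  have v: "v = (\<Sum>i\<in>set_pmf N0. pmf N0 i *\<^sub>R fst (z i))"
    and \<alpha>: "\<alpha> = (\<Sum>i\<in>set_pmf N0. pmf N0 i * fst (snd (z i)))"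
    and \<beta>: "\<beta> = (\<Sum>i\<in>set_pmf N0. pmf N0 i * snd (snd (z i)))"
    and \<gamma>: "\<gamma> = (\<Sum>i\<in>set_pmf N0. pmf N0 i * (ent_Y W (fst (z i)) - ent_Z W (fst (z i))))"
    using N0(3) by (simp_all add: z(2) sum_prod)
  \<comment> \<open>Summing over \<open>t\<close> inside a cell recovers the law of \<open>X\<close>
    given \<open>Q = i\<close>, the vector at which the last coordinate of \<open>gen_Q\<close> was
    evaluated.\<close>
  have rowq: "joint_row N (\<lambda>w. \<phi> (fst w)) snd i = pmf N0 i *\<^sub>R fst (z i)" if i: "i \<in> set_pmf N0" for i
  proof -
    have "joint_row N (\<lambda>w. \<phi> (fst w)) snd i = (\<Sum>t | t \<in> fst ` set_pmf N \<and> \<phi> t = i. joint_row N fst snd t)"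
      using sum_joint_row_fibre[OF fin, where T = fst and \<phi> = \<phi> and q = i and A = snd] by simp
    also have "{t. t \<in> fst ` set_pmf N \<and> \<phi> t = i} = (\<lambda>t. prod_encode (i, t)) ` fst ` set_pmf (L i)"
      unfolding fstN \<phi>_def using i by (auto, force)
    also have "(\<Sum>t\<in>(\<lambda>t. prod_encode (i, t)) ` fst ` set_pmf (L i). joint_row N fst snd t) =
        (\<Sum>t\<in>fst ` set_pmf (L i). pmf N0 i *\<^sub>R joint_row (L i) fst snd t)"
      by (subst sum.reindex) (auto simp: inj_on_def row)
    also have "\<dots> = pmf N0 i *\<^sub>R law (L i) snd"
      using L(1) by (simp add: scaleR_sum_right[symmetric] sum_joint_row)
    finally show ?thesis by (simp add: L(5))
  qed
  have imq: "(\<lambda>w. \<phi> (fst w)) ` set_pmf N = set_pmf N0"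
  proof -
    have "(\<lambda>w. \<phi> (fst w)) ` set_pmf N = \<phi> ` fst ` set_pmf N" by auto
    also have "\<dots> = set_pmf N0"
      unfolding fstN using set_pmf_not_empty[of "L _"] by (force simp: \<phi>_def image_iff)
    finally show ?thesis .
  qed
  have zs: "fst (z i) \<in> prob_simplex" for i using fst_hull_T[OF z(1)] .
  have scale: "ent_Y W (pmf N0 i *\<^sub>R u) = pmf N0 i * ent_Y W u" "ent_Z W (pmf N0 i *\<^sub>R u) = pmf N0 i * ent_Z W u"
    if "\<And>a. 0 \<le> u $ a" for i u
    unfolding ent_Y_def ent_Z_def using that by (simp_all add: output_ent_scale)
  show thesis
  proof (rule that[of N \<phi>])
    show "finite (set_pmf N)" by (rule fin)
    have "law N snd = (\<Sum>i\<in>set_pmf N0. joint_row N (\<lambda>w. \<phi> (fst w)) snd i)"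
      using sum_joint_row[OF fin, of "set_pmf N0" "\<lambda>w. \<phi> (fst w)" snd] N0(1) imq by simp
    then show "law N snd = v" by (simp add: rowq v)
    show "(\<Sum>t\<in>fst ` set_pmf N. ent_Y W (joint_row N fst snd t)) = \<alpha>"
      unfolding reindex \<alpha> zY by (simp add: scale joint_row_def sum_distrib_left)
    show "(\<Sum>t\<in>fst ` set_pmf N. ent_Z W (joint_row N fst snd t)) = \<beta>"
      unfolding reindex \<beta> zZ by (simp add: scale joint_row_def sum_distrib_left)
    show "(\<Sum>q\<in>(\<lambda>w. \<phi> (fst w)) ` set_pmf N. ent_Y W (joint_row N (\<lambda>w. \<phi> (fst w)) snd q)
        - ent_Z W (joint_row N (\<lambda>w. \<phi> (fst w)) snd q)) = \<gamma>"
      unfolding imq \<gamma> using zs by (intro sum.cong) (auto simp: rowq scale prob_simplex_def right_diff_distrib)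
  qed
qed

section \<open>Assembling the single-letter joint law\<close>

lemma source_kernel:
  fixes p :: "('a \<times> 'c) pmf"
  obtains K where "p = bind_pmf p (\<lambda>s. map_pmf (Pair (fst s)) (K (fst s)))"
proof -
  obtain K where K: "map_pmf prod.swap p = bind_pmf (map_pmf snd (map_pmf prod.swap p)) (\<lambda>a. map_pmf (\<lambda>i. (i, a)) (K a))"
    using pmf_disintegrate[of "map_pmf prod.swap p"] by metis
  have "p = map_pmf prod.swap (map_pmf prod.swap p)"
    by (simp add: pmf.map_comp o_def)
  also have "\<dots> = bind_pmf p (\<lambda>s. map_pmf (Pair (fst s)) (K (fst s)))"
    by (subst K) (simp add: map_bind_pmf bind_map_pmf pmf.map_comp o_def)
  finally show thesis by (rule that)
qed

text \<open>With \<open>pair_pmf\<close>, \<open>U\<close> and \<open>V\<close> are drawn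
  independently given \<open>A\<close>, so the laws belonging to the points of the \<open>U\<close>
  and \<open>V\<close> hulls can be prescribed separately.\<close>

lemma sl_joint_laws:
  fixes p :: "('a \<times> 'b \<times> 'e) pmf"
  assumes J: "J = sl_joint p W (\<lambda>a. pair_pmf (pu a) (pv a)) px pt pq"
  shows "map_pmf (\<lambda>w. (rvU w, rvA w, rvB w, rvE w)) J = bind_pmf p (\<lambda>s. map_pmf (\<lambda>u. (u, s)) (pu (fst s)))"
    and "map_pmf (\<lambda>w. (rvV w, rvA w, rvB w, rvE w)) J = bind_pmf p (\<lambda>s. map_pmf (\<lambda>u. (u, s)) (pv (fst s)))"
    and "map_pmf (\<lambda>w. (rvT w, rvX w, rvY w, rvZ w)) J =
      bind_pmf px (\<lambda>x. bind_pmf (pt x) (\<lambda>t. map_pmf (\<lambda>c. (t, x, c)) (W x)))"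
  unfolding J sl_joint_def pair_pmf_def
  by (simp_all add: map_bind_pmf bind_assoc_pmf bind_return_pmf pmf.map_comp o_def case_prod_unfold
      rvU_def rvV_def rvT_def rvX_def rvY_def rvZ_def rvA_def rvB_def rvE_def map_pmf_const
      bind_return_pmf' map_pmf_def[symmetric])

lemma markov_of_law:
  assumes N: "map_pmf (\<lambda>w. (F w, A w, C w)) J = bind_pmf N (\<lambda>(f, a). map_pmf (\<lambda>c. (f, a, c)) (K a))"
  shows "markov J F A C K" "map_pmf (\<lambda>w. (F w, A w)) J = N"
proof -
  have "map_pmf (\<lambda>w. (F w, A w)) J = map_pmf (\<lambda>(f, a, c). (f, a)) (map_pmf (\<lambda>w. (F w, A w, C w)) J)"
    by (simp add: pmf.map_comp o_def)
  also have "\<dots> = N"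
    unfolding N by (simp add: map_bind_pmf pmf.map_comp o_def case_prod_unfold map_pmf_const bind_return_pmf')
  finally show eq: "map_pmf (\<lambda>w. (F w, A w)) J = N" .
  show "markov J F A C K"
    unfolding markov_def N eq[symmetric] by (simp add: bind_map_pmf)
qed

text \<open>The auxiliary variable and \<open>(B, E)\<close> are both drawn from \<open>A\<close>,
  so their draws may be interchanged. This brings the law into the form that
  \<open>markov_of_law\<close> reads.\<close>

lemma source_law_eq:
  assumes K: "p = bind_pmf p (\<lambda>s. map_pmf (Pair (fst s)) (K (fst s)))"
    and N: "N = bind_pmf (map_pmf fst p) (\<lambda>a. map_pmf (\<lambda>i. (i, a)) (k a))"
  shows "bind_pmf p (\<lambda>s. map_pmf (\<lambda>u. (u, s)) (k (fst s))) = bind_pmf N (\<lambda>(f, a). map_pmf (\<lambda>c. (f, a, c)) (K a))"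
proof -
  have "bind_pmf p (\<lambda>s. map_pmf (\<lambda>u. (u, s)) (k (fst s))) =
      bind_pmf (bind_pmf p (\<lambda>s. map_pmf (Pair (fst s)) (K (fst s)))) (\<lambda>s. map_pmf (\<lambda>u. (u, s)) (k (fst s)))"
    using K by simp
  also have "\<dots> = bind_pmf p (\<lambda>s. bind_pmf (K (fst s)) (\<lambda>c. bind_pmf (k (fst s)) (\<lambda>u. return_pmf (u, fst s, c))))"
    by (simp add: bind_assoc_pmf bind_map_pmf map_pmf_def[of "\<lambda>u. (u, _)"])
  also have "\<dots> = bind_pmf p (\<lambda>s. bind_pmf (k (fst s)) (\<lambda>u. bind_pmf (K (fst s)) (\<lambda>c. return_pmf (u, fst s, c))))"
    by (subst bind_commute_pmf) simp
  also have "\<dots> = bind_pmf N (\<lambda>(f, a). map_pmf (\<lambda>c. (f, a, c)) (K a))"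
    unfolding N by (simp add: bind_assoc_pmf bind_map_pmf bind_return_pmf map_pmf_def)
  finally show ?thesis .
qed

lemma joint_row_map: "map_pmf (\<lambda>w. (F w, A w)) J = N \<Longrightarrow> joint_row J F A = joint_row N fst snd"
  by (auto simp: joint_row_def fun_eq_iff vec_eq_iff)

lemma joint_row_map_comp:
  "map_pmf (\<lambda>w. (F w, A w)) J = N \<Longrightarrow> joint_row J (\<lambda>w. \<phi> (F w)) A = joint_row N (\<lambda>w. \<phi> (fst w)) snd"
  by (auto simp: joint_row_def fun_eq_iff vec_eq_iff pmf.map_comp o_def)

lemma image_map_pmf: "map_pmf (\<lambda>w. (F w, A w)) J = N \<Longrightarrow> F ` set_pmf J = fst ` set_pmf N"
  by (auto simp: image_image)

theorem theorem2:
  fixes p :: "('a::finite \<times> 'b::finite \<times> 'e::finite) pmf"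
    and W :: "'x::finite \<Rightarrow> ('y::finite \<times> 'z::finite) pmf"
    and d :: "'a \<Rightarrow> 'a \<Rightarrow> real"
    and k D \<Delta> :: real
  assumes d_nonneg: "\<forall>a a'. 0 \<le> d a a'"
    and ach: "achievable p W d k D \<Delta>"
  shows "\<exists>(puv :: 'a \<Rightarrow> (nat \<times> nat) pmf) (px :: 'x pmf) (pt :: 'x \<Rightarrow> nat pmf)
            (pq :: nat \<Rightarrow> nat pmf) (Ahat :: nat \<Rightarrow> 'b \<Rightarrow> 'a).
           (let J = sl_joint p W puv px pt pq in
              finite (set_pmf J)
            \<and> cond_mutual_info J rvV rvA rvB \<le> k * mutual_info J rvT rvY
            \<and> D \<ge> measure_pmf.expectation J (\<lambda>w. d (rvA w) (Ahat (rvV w) (rvB w)))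
            \<and> \<Delta> \<le> cond_ent J rvA (\<lambda>w. (rvU w, rvE w))
                 - max 0 (cond_mutual_info J rvV rvA rvB - cond_mutual_info J rvU rvA rvB
                          - k * (cond_mutual_info J rvT rvY rvQ - cond_mutual_info J rvT rvZ rvQ)))"
proof -
  obtain K where K: "p = bind_pmf p (\<lambda>s. map_pmf (Pair (fst s)) (K (fst s)))"
    by (rule source_kernel)
  obtain hv \<delta> he hb v \<alpha> \<beta> \<gamma> where
    V: "(law p fst, hv, \<delta>) \<in> convex hull (gen_V K d)" and
    U: "(law p fst, he, hb) \<in> convex hull (gen_U K)" and
    Q: "(v, \<alpha>, \<beta>, \<gamma>) \<in> convex hull (gen_Q W)" and
    ineq: "ent p (\<lambda>s. (fst s, fst (snd s))) - ent p (\<lambda>s. fst (snd s)) - hv \<le> k * (ent_Y W v - \<alpha>)"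
      "\<delta> \<le> D" "\<Delta> \<le> he" "\<Delta> \<le> he + hv - hb + k * (\<gamma> - \<alpha> + \<beta>)"
    using achievable_imp_point[OF ach K] by blast
  obtain NV :: "(nat \<times> 'a) pmf" and xV where NV: "finite (set_pmf NV)" "\<And>i. xV i \<in> gen_V K d"
    "\<And>i. joint_row NV fst snd i = pmf (map_pmf fst NV) i *\<^sub>R fst (xV i)"
    "(law p fst, hv, \<delta>) = (\<Sum>i\<in>fst ` set_pmf NV. pmf (map_pmf fst NV) i *\<^sub>R xV i)"
    "law NV snd = fst (law p fst, hv, \<delta>)"
    by (rule convex_hull_joint_pmf[OF V gen_fst_simplex(1)], assumption) (rule that)
  obtain NU :: "(nat \<times> 'a) pmf" and xU where NU: "finite (set_pmf NU)" "\<And>i. xU i \<in> gen_U K"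
    "\<And>i. joint_row NU fst snd i = pmf (map_pmf fst NU) i *\<^sub>R fst (xU i)"
    "(law p fst, he, hb) = (\<Sum>i\<in>fst ` set_pmf NU. pmf (map_pmf fst NU) i *\<^sub>R xU i)"
    "law NU snd = fst (law p fst, he, hb)"
    by (rule convex_hull_joint_pmf[OF U gen_fst_simplex(2)], assumption) (rule that)
  obtain NT :: "(nat \<times> 'x) pmf" and \<phi> :: "nat \<Rightarrow> nat" where NT: "finite (set_pmf NT)" "law NT snd = v"
    "(\<Sum>t\<in>fst ` set_pmf NT. ent_Y W (joint_row NT fst snd t)) = \<alpha>"
    "(\<Sum>t\<in>fst ` set_pmf NT. ent_Z W (joint_row NT fst snd t)) = \<beta>"
    "(\<Sum>q\<in>(\<lambda>w. \<phi> (fst w)) ` set_pmf NT. ent_Y W (joint_row NT (\<lambda>w. \<phi> (fst w)) snd q)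
        - ent_Z W (joint_row NT (\<lambda>w. \<phi> (fst w)) snd q)) = \<gamma>"
    by (rule hull_Q_joint_pmf[OF Q])
  obtain pv where pv: "NV = bind_pmf (map_pmf snd NV) (\<lambda>a. map_pmf (\<lambda>i. (i, a)) (pv a))"
    "\<And>a. finite (set_pmf (pv a))" using pmf_disintegrate[of NV] NV(1) by metis
  obtain pu where pu: "NU = bind_pmf (map_pmf snd NU) (\<lambda>a. map_pmf (\<lambda>i. (i, a)) (pu a))"
    "\<And>a. finite (set_pmf (pu a))" using pmf_disintegrate[of NU] NU(1) by metis
  obtain pt where pt: "NT = bind_pmf (map_pmf snd NT) (\<lambda>a. map_pmf (\<lambda>i. (i, a)) (pt a))"
    "\<And>a. finite (set_pmf (pt a))" using pmf_disintegrate[of NT] NT(1) by metis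
  \<comment> \<open>Each generator comes with its own rule, so the value of \<open>V\<close> selects
    the reconstruction.\<close>
  have "\<exists>f. xV i = (fst (xV i), ent_src_B K (fst (xV i)), src_dist K d f (fst (xV i)))" for i
    using NV(2)[of i] by (auto simp: gen_V_def)
  then obtain Ahat where Ahat: "\<And>i. xV i = (fst (xV i), ent_src_B K (fst (xV i)), src_dist K d (Ahat i) (fst (xV i)))"
    by metis
  define px where "px = map_pmf snd NT"
  \<comment> \<open>\<open>Q\<close> is a deterministic function of \<open>T\<close>, so entropies
    given \<open>(T, Q)\<close> are entropies given \<open>T\<close>.\<close>
  define pq where "pq t = return_pmf (\<phi> t)" for t
  define J where "J = sl_joint p W (\<lambda>a. pair_pmf (pu a) (pv a)) px pt pq"
  have fin: "finite (set_pmf J)"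
    unfolding J_def sl_joint_def pq_def using pu(2) pv(2) pt(2)
    by (auto simp: case_prod_unfold intro!: finite_UN_I finite_imageI)
  have sndV: "map_pmf snd NV = map_pmf fst p" and sndU: "map_pmf snd NU = map_pmf fst p"
    using NV(5) NU(5) by (auto intro: law_eq_imp_map_pmf_eq)
  have lawV: "map_pmf (\<lambda>w. (rvV w, rvA w, (rvB w, rvE w))) J = bind_pmf NV (\<lambda>(f, a). map_pmf (\<lambda>c. (f, a, c)) (K a))"
    unfolding sl_joint_laws(2)[OF J_def] by (rule source_law_eq[OF K pv(1)[unfolded sndV]])
  have lawU: "map_pmf (\<lambda>w. (rvU w, rvA w, (rvB w, rvE w))) J = bind_pmf NU (\<lambda>(f, a). map_pmf (\<lambda>c. (f, a, c)) (K a))"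
    unfolding sl_joint_laws(1)[OF J_def] by (rule source_law_eq[OF K pu(1)[unfolded sndU]])
  have lawT: "map_pmf (\<lambda>w. (rvT w, rvX w, (rvY w, rvZ w))) J = bind_pmf NT (\<lambda>(f, a). map_pmf (\<lambda>c. (f, a, c)) (W a))"
    unfolding sl_joint_laws(3)[OF J_def] px_def by (subst (2) pt(1)) (simp add: bind_assoc_pmf bind_map_pmf)
  note mV = markov_of_law[OF lawV] and mU = markov_of_law[OF lawU] and mT = markov_of_law[OF lawT]
  have "map_pmf (\<lambda>w. (rvA w, rvB w, rvE w)) J = map_pmf snd (map_pmf (\<lambda>w. (rvV w, rvA w, rvB w, rvE w)) J)"
    by (simp add: pmf.map_comp o_def)
  also have "\<dots> = p"
    unfolding sl_joint_laws(2)[OF J_def] by (simp add: map_bind_pmf pmf.map_comp o_def map_pmf_const bind_return_pmf')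
  finally have lawp: "map_pmf (\<lambda>w. (rvA w, rvB w, rvE w)) J = p" .
  have HAB: "ent J (\<lambda>w. (rvA w, rvB w)) = ent p (\<lambda>s. (fst s, fst (snd s)))" "ent J rvB = ent p (\<lambda>s. fst (snd s))"
    unfolding lawp[symmetric] ent_map_pmf by simp_all

  have srcB: "cond_ent J (\<lambda>w. (rvA w, rvB w)) F - cond_ent J rvB F = (\<Sum>f\<in>F ` set_pmf J. ent_src_B K (joint_row J F rvA f))"
    and srcE: "cond_ent J (\<lambda>w. (rvA w, rvE w)) F - cond_ent J rvE F = (\<Sum>f\<in>F ` set_pmf J. ent_src_E K (joint_row J F rvA f))"
    if mk: "markov J F rvA (\<lambda>w. (rvB w, rvE w)) K" for F :: "_ \<Rightarrow> nat"
  proof -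
    have "markov J F rvA (\<lambda>w. (rvA w, rvB w)) (\<lambda>a. map_pmf (\<lambda>c. (a, fst c)) (K a))"
      "markov J F rvA rvB (\<lambda>a. map_pmf fst (K a))"
      "markov J F rvA (\<lambda>w. (rvA w, rvE w)) (\<lambda>a. map_pmf (\<lambda>c. (a, snd c)) (K a))"
      "markov J F rvA rvE (\<lambda>a. map_pmf snd (K a))"
      using markov_comp[OF mk, of "\<lambda>f _. f" "\<lambda>a c. (a, fst c)"] markov_comp[OF mk, of "\<lambda>f _. f" "\<lambda>_. fst"]
        markov_comp[OF mk, of "\<lambda>f _. f" "\<lambda>a c. (a, snd c)"] markov_comp[OF mk, of "\<lambda>f _. f" "\<lambda>_. snd"]
      by simp_all
    note this[THEN cond_ent_markov[OF fin]]
    then show "cond_ent J (\<lambda>w. (rvA w, rvB w)) F - cond_ent J rvB F = (\<Sum>f\<in>F ` set_pmf J. ent_src_B K (joint_row J F rvA f))"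
      "cond_ent J (\<lambda>w. (rvA w, rvE w)) F - cond_ent J rvE F = (\<Sum>f\<in>F ` set_pmf J. ent_src_E K (joint_row J F rvA f))"
      by (simp_all add: ent_src_B_def ent_src_E_def sum_subtractf)
  qed
  have hom: "ent_src_B K (r *\<^sub>R u) = r * ent_src_B K u" "ent_src_E K (r *\<^sub>R u) = r * ent_src_E K u"
    "src_dist K d f (r *\<^sub>R u) = r * src_dist K d f u"
    if "0 \<le> r" "u \<in> prob_simplex" for r u f
    using that by (auto simp: ent_src_B_def ent_src_E_def src_dist_def prob_simplex_def output_ent_scale
        right_diff_distrib sum_distrib_left mult.assoc)
  have simV: "fst (xV i) \<in> prob_simplex" and simU: "fst (xU i) \<in> prob_simplex" for i
    using NV(2) NU(2) gen_fst_simplex by blast+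
  have xV: "fst (snd (xV i)) = ent_src_B K (fst (xV i))" "snd (snd (xV i)) = src_dist K d (Ahat i) (fst (xV i))" for i
    using Ahat[of i] by (metis fst_conv snd_conv)+
  have xU: "fst (snd (xU i)) = ent_src_E K (fst (xU i))" "snd (snd (xU i)) = ent_src_B K (fst (xU i))" for i
    using NU(2)[of i] by (auto simp: gen_U_def)
  have hv: "hv = fst (snd (\<Sum>i\<in>fst ` set_pmf NV. pmf (map_pmf fst NV) i *\<^sub>R xV i))"
    and \<delta>: "\<delta> = snd (snd (\<Sum>i\<in>fst ` set_pmf NV. pmf (map_pmf fst NV) i *\<^sub>R xV i))"
    and he: "he = fst (snd (\<Sum>i\<in>fst ` set_pmf NU. pmf (map_pmf fst NU) i *\<^sub>R xU i))"
    and hb: "hb = snd (snd (\<Sum>i\<in>fst ` set_pmf NU. pmf (map_pmf fst NU) i *\<^sub>R xU i))"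
    unfolding NV(4)[symmetric] NU(4)[symmetric] by simp_all
  have "cond_ent J (\<lambda>w. (rvA w, rvB w)) rvV - cond_ent J rvB rvV = hv"
    unfolding srcB[OF mV(1)] joint_row_map[OF mV(2)] image_map_pmf[OF mV(2)] NV(3) hv
    by (simp only: fst_sum snd_sum fst_scaleR snd_scaleR xV hom[OF pmf_nonneg simV] real_scaleR_def)
  moreover have "ent J (\<lambda>w. (rvV w, rvA w, rvB w)) = ent J (\<lambda>w. ((rvA w, rvB w), rvV w))"
    "ent J (\<lambda>w. (rvV w, rvB w)) = ent J (\<lambda>w. (rvB w, rvV w))"
    by (rule ent_cong; auto)+
  ultimately have IV: "cond_mutual_info J rvV rvA rvB = ent p (\<lambda>s. (fst s, fst (snd s))) - ent p (\<lambda>s. fst (snd s)) - hv"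
    by (simp add: cond_mutual_info_def cond_ent_def HAB)
  have "cond_ent J (\<lambda>w. (rvA w, rvB w)) rvU - cond_ent J rvB rvU = hb"
    unfolding srcB[OF mU(1)] joint_row_map[OF mU(2)] image_map_pmf[OF mU(2)] NU(3) hb
    by (simp only: fst_sum snd_sum fst_scaleR snd_scaleR xU hom[OF pmf_nonneg simU] real_scaleR_def)
  moreover have "ent J (\<lambda>w. (rvU w, rvA w, rvB w)) = ent J (\<lambda>w. ((rvA w, rvB w), rvU w))"
    "ent J (\<lambda>w. (rvU w, rvB w)) = ent J (\<lambda>w. (rvB w, rvU w))"
    by (rule ent_cong; auto)+
  ultimately have IU: "cond_mutual_info J rvU rvA rvB = ent p (\<lambda>s. (fst s, fst (snd s))) - ent p (\<lambda>s. fst (snd s)) - hb"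
    by (simp add: cond_mutual_info_def cond_ent_def HAB)
  have "cond_ent J (\<lambda>w. (rvA w, rvE w)) rvU - cond_ent J rvE rvU = he"
    unfolding srcE[OF mU(1)] joint_row_map[OF mU(2)] image_map_pmf[OF mU(2)] NU(3) he
    by (simp only: fst_sum snd_sum fst_scaleR snd_scaleR xU hom[OF pmf_nonneg simU] real_scaleR_def)
  moreover have "ent J (\<lambda>w. (rvA w, rvU w, rvE w)) = ent J (\<lambda>w. ((rvA w, rvE w), rvU w))"
    "ent J (\<lambda>w. (rvU w, rvE w)) = ent J (\<lambda>w. (rvE w, rvU w))"
    by (rule ent_cong; auto)+
  ultimately have HUE: "cond_ent J rvA (\<lambda>w. (rvU w, rvE w)) = he"
    by (simp add: cond_ent_def)
  have ED: "measure_pmf.expectation J (\<lambda>w. d (rvA w) (Ahat (rvV w) (rvB w))) = \<delta>"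
  proof -
    have "measure_pmf.expectation J (\<lambda>w. d (rvA w) (Ahat (rvV w) (rvB w))) =
        (\<Sum>f\<in>rvV ` set_pmf J. src_dist K d (Ahat f) (joint_row J rvV rvA f))"
      using expectation_markov[OF fin mV(1), of "\<lambda>f a c. d a (Ahat f (fst c))"] by (simp add: src_dist_def)
    also have "\<dots> = \<delta>"
      unfolding joint_row_map[OF mV(2)] image_map_pmf[OF mV(2)] NV(3) \<delta>
      by (simp only: fst_sum snd_sum fst_scaleR snd_scaleR xV hom[OF pmf_nonneg simV] real_scaleR_def)
    finally show ?thesis .
  qed

  have chan: "markov J rvT rvX rvY (\<lambda>x. map_pmf fst (W x))" "markov J rvT rvX rvZ (\<lambda>x. map_pmf snd (W x))"
    "markov J (\<lambda>w. \<phi> (rvT w)) rvX rvY (\<lambda>x. map_pmf fst (W x))"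
    "markov J (\<lambda>w. \<phi> (rvT w)) rvX rvZ (\<lambda>x. map_pmf snd (W x))"
    using markov_comp[OF mT(1), of "\<lambda>f _. f" "\<lambda>_. fst"] markov_comp[OF mT(1), of "\<lambda>f _. f" "\<lambda>_. snd"]
      markov_comp[OF mT(1), of "\<lambda>f _. \<phi> f" "\<lambda>_. fst"] markov_comp[OF mT(1), of "\<lambda>f _. \<phi> f" "\<lambda>_. snd"]
    by simp_all
  have hYT: "cond_ent J rvY rvT = \<alpha>" and hZT: "cond_ent J rvZ rvT = \<beta>"
    unfolding cond_ent_markov[OF fin chan(1)] cond_ent_markov[OF fin chan(2)]
      joint_row_map[OF mT(2)] image_map_pmf[OF mT(2)] using NT(3,4) by (simp_all add: ent_Y_def ent_Z_def)
  have im: "(\<lambda>w. \<phi> (rvT w)) ` set_pmf J = (\<lambda>w. \<phi> (fst w)) ` set_pmf NT"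
    using image_map_pmf[OF mT(2)] by (metis image_image)
  have hQ: "cond_ent J rvY (\<lambda>w. \<phi> (rvT w)) - cond_ent J rvZ (\<lambda>w. \<phi> (rvT w)) = \<gamma>"
    unfolding cond_ent_markov[OF fin chan(3)] cond_ent_markov[OF fin chan(4)]
      joint_row_map_comp[OF mT(2)] im using NT(5) by (simp add: ent_Y_def ent_Z_def sum_subtractf)
  have QT: "rvQ w = \<phi> (rvT w)" if "w \<in> set_pmf J" for w
    using that by (auto simp: J_def sl_joint_def pq_def rvQ_def rvT_def)
  have "law J rvX = v"
    using mT(2) NT(2) by (simp add: law_def pmf.map_comp o_def vec_eq_iff flip: mT(2))
  then have "ent J rvY = ent_Y W v"
    using ent_markov[OF fin chan(1)] by (simp add: ent_Y_def)
  moreover have "ent J (\<lambda>w. (rvT w, rvY w)) = ent J (\<lambda>w. (rvY w, rvT w))" by (rule ent_cong) auto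
  ultimately have IT: "mutual_info J rvT rvY = ent_Y W v - \<alpha>"
    using hYT by (simp add: mutual_info_def cond_ent_def)
  have IQ: "cond_mutual_info J rvT rvY rvQ - cond_mutual_info J rvT rvZ rvQ = \<gamma> - \<alpha> + \<beta>"
  proof -
    have "ent J (\<lambda>w. (rvY w, rvQ w)) = ent J (\<lambda>w. (rvY w, \<phi> (rvT w)))"
      "ent J (\<lambda>w. (rvZ w, rvQ w)) = ent J (\<lambda>w. (rvZ w, \<phi> (rvT w)))"
      "ent J (\<lambda>w. (rvT w, rvY w, rvQ w)) = ent J (\<lambda>w. (rvY w, rvT w))"
      "ent J (\<lambda>w. (rvT w, rvZ w, rvQ w)) = ent J (\<lambda>w. (rvZ w, rvT w))"
      by (rule ent_cong; auto simp: QT)+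
    then show ?thesis
      using hYT hZT hQ by (simp add: cond_mutual_info_def cond_ent_def)
  qed
  \<comment> \<open>The maximum splits into the last two bounds of \<open>ineq\<close>: \<Delta> at
    most \<open>he\<close> where it is 0, the full sum otherwise.\<close>
  have "finite (set_pmf J) \<and> cond_mutual_info J rvV rvA rvB \<le> k * mutual_info J rvT rvY
      \<and> D \<ge> measure_pmf.expectation J (\<lambda>w. d (rvA w) (Ahat (rvV w) (rvB w)))
      \<and> \<Delta> \<le> cond_ent J rvA (\<lambda>w. (rvU w, rvE w))
           - max 0 (cond_mutual_info J rvV rvA rvB - cond_mutual_info J rvU rvA rvB
                    - k * (cond_mutual_info J rvT rvY rvQ - cond_mutual_info J rvT rvZ rvQ))"
    unfolding IV IU IT IQ HUE ED using fin ineq by auto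
  then show ?thesis unfolding J_def Let_def by blast
qed

end
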